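(* Let $\mathcal{A}$ be a finitely generated $\mathcal{D}$-based quasivariety with language $\mathcal{L}$. Let $\mathfrak{M}$ be a finite set of finite algebras such that $\mathcal{A}=\mathbb{ISP}(\mathfrak{M})$ and let $\Omega\subseteq\dot\bigcup_{\mathbf{M}\in\mathfrak{M}}HU(\mathbf{M})$ satisfy $(\mathrm{Sep})_{\mathfrak{M},\Omega}$. Then the following statements are equivalent: (1) $U$ satisfies (S), that is, for every set $\mathfrak{K}$ of algebras in $\mathcal{A}$, the image of $\chi_{\mathfrak{K}}$ is $U(\coprod\mathfrak{K})$; (2) for every finite set $\mathfrak{K}$ of disjoint copies of $\mathbf{F}_{\mathcal{A}}(1)$, the image of $\chi_{\mathfrak{K}}$ is $U(\coprod\mathfrak{K})$; (3) for every $n\geq 1$ and every $n$-ary term $t$ in the language $\mathcal{L}$ of $\mathcal{A}$ there exist unary terms $t_1,\ldots,t_n$ in $\mathcal{L}$ and an $n$-ary term $s$ in the language of $\mathcal{D}$ such that $$t^{\mathbf{A}}(a_1,\ldots,a_n)=s^{\mathbf{A}}\bigl(t_1^{\mathbf{A}}(a_1),\ldots,t_n^{\mathbf{A}}(a_n)\bigr)$$ for every $\mathbf{A}\in\mathcal{A}$ and every $a_1,\ldots,a_n\in\mathbf{A}$; (4) for every $\mathbf{A}\in\mathcal{A}$ and every bounded sublattice $\mathbf{L}$ of $U(\mathbf{A})$, either $L$ contains no $\mathcal{A}$-subalgebra of $\mathbf{A}$ or $\{\mathbf{B}\in\mathbb{S}(\mathbf{A})\mid B\subseteq L\}$ has a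 top element; (5) for every $\omega_1,\omega_2\in\Omega$ it is the case that $|R_{\omega_1,\omega_2}|\leq 1$; (6) for every set of algebras $\mathfrak{K}\subseteq\mathcal{A}$, the map $\iota_{\mathfrak{K}}$ is an order embedding.
   Context: $\mathcal{D}$ is the category of bounded distributive lattices with lattice homomorphisms preserving $0$ and $1$; $\mathbf{2}$ is the two-element member. A class $\mathcal{A}$ of algebras in a common language is $\mathcal{D}$-based if the language contains (up to term-equivalence) $\wedge,\vee,0,1$ in such a way that for every $\mathbf{A}\in\mathcal{A}$ the reduct $U(\mathbf{A})=(A,\wedge,\vee,0,1)$ belongs to $\mathcal{D}$; with $U(h)=h$ this gives the forgetful functor $U\colon\mathcal{A}\to\mathcal{D}$. $\mathcal{A}(\cdot,\cdot)$, $\mathcal{D}(\cdot,\cdot)$ denote hom-sets. $\mathbb{ISP}(\mathfrak{M})$ is the class of isomorphic copies of subalgebras of products of members of $\mathfrak{M}$; a quasivariety is finitely generated if it is $\mathbb{ISP}(\mathfrak{M})$ for a finite set $\mathfrak{M}$ of finite algebras. $\mathbf{F}_{\mathcal{A}}(1)$ is the free algebra in $\mathcal{A}$ on one generator. $\mathbb{S}(\mathbf{A})$ is the set of subalgebras of $\mathbf{A}$ ordered by inclusion. $H\colon\mathcal{D}\to\mathcal{P}$ is the Priestley duality functor into the category $\mathcal{P}$ of Priestley spaces: $H(\mathbf{L})=\mathcal{D}(\mathbf{L},\mathbf{2})$ with pointwise order and topology inherited from the power $\{0,1\}^L$ of the discrete space, and $H(f)=-\circ f$. Write $\Omega_{\mathbf{M}}$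 for the set of members of $\Omega$ lying in $HU(\mathbf{M})=\mathcal{D}(U(\mathbf{M}),\mathbf{2})$. Separation condition $(\mathrm{Sep})_{\mathfrak{M},\Omega}$: for all $\mathbf{M}\in\mathfrak{M}$ and $a\neq b$ in $\mathbf{M}$ there exist $\mathbf{M}'\in\mathfrak{M}$, $u\in\mathcal{A}(\mathbf{M},\mathbf{M}')$ and $\omega\in\Omega_{\mathbf{M}'}$ with $\omega(u(a))\neq\omega(u(b))$. For $\omega_i\in\Omega_{\mathbf{M}_i}$ ($i=1,2$), let $(\omega_1,\omega_2)^{-1}(\leqslant)=\{(a,b)\in\mathbf{M}_1\times\mathbf{M}_2\mid\omega_1(a)\leq\omega_2(b)\}$; $R_{\omega_1,\omega_2}$ is the (possibly empty) set of subalgebras of $\mathbf{M}_1\times\mathbf{M}_2$ that are maximal among the subalgebras contained in $(\omega_1,\omega_2)^{-1}(\leqslant)$. For a set $\mathfrak{K}\subseteq\mathcal{A}$, let $\{\epsilon_{\mathbf{B}}\colon\mathbf{B}\to\coprod\mathfrak{K}\}_{\mathbf{B}\in\mathfrak{K}}$ be the coproduct co-cone in $\mathcal{A}$ and $\{\varepsilon_{\mathbf{B}}\colon U(\mathbf{B})\to\coprod U(\mathfrak{K})\}_{\mathbf{B}\in\mathfrak{K}}$ the coproduct co-cone in $\mathcal{D}$ of the family $U(\mathfrak{K})$ of the lattices $U(\mathbf{B})$. Then $\chi_{\mathfrak{K}}\colon\coprod U(\mathfrak{K})\to U(\coprod\mathfrak{K})$ is the unique $\mathcal{D}$-morphism with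 $\chi_{\mathfrak{K}}\circ\varepsilon_{\mathbf{B}}=U(\epsilon_{\mathbf{B}})$ for each $\mathbf{B}\in\mathfrak{K}$. $H$ sends coproducts to cartesian products, so $H(\coprod U(\mathfrak{K}))$ is identified with $\prod_{\mathbf{B}\in\mathfrak{K}}HU(\mathbf{B})$, with projections $H(\varepsilon_{\mathbf{B}})$. Under this identification $\iota_{\mathfrak{K}}=H(\chi_{\mathfrak{K}})\colon HU(\coprod\mathfrak{K})\to\prod_{\mathbf{B}\in\mathfrak{K}}HU(\mathbf{B})$, i.e. $\iota_{\mathfrak{K}}(y)=(y\circ\epsilon_{\mathbf{B}})_{\mathbf{B}\in\mathfrak{K}}$.
   Formalization: In (3), s may have any arity and take finitely many unary terms per variable (as printed it fails for symmetric difference in Boolean algebras); in (1), (2), (6) K is nonempty (empty K fails for the chain 0<c<1 with constant c); algebras live on an arbitrary infinite carrier type. *)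

theory Defs
  imports Main "HOL-Library.FuncSet"
begin

section \<open>Algebras and terms over a finitary language\<close>

text \<open>A language is a type \<open>'f\<close> of operation symbols together with an arity function
  \<open>ar :: 'f \<Rightarrow> nat\<close>. The value of \<^term>\<open>opn A f xs\<close> matters only for argument lists of length
  \<open>ar f\<close> over the carrier.\<close>

datatype (funs: 'f, vars: 'v) trm = Var 'v | App 'f "('f, 'v) trm list"

fun wf_trm :: "('f \<Rightarrow> nat) \<Rightarrow> ('f, 'v) trm \<Rightarrow> bool" where
  "wf_trm ar (Var v) \<longleftrightarrow> True"
| "wf_trm ar (App f ts) \<longleftrightarrow> length ts = ar f \<and> (\<forall>t\<in>set ts. wf_trm ar t)"

text \<open>The \<open>n\<close>-ary terms are those in the variables \<open>0, \<dots>, n - 1\<close>.\<close>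

definition nary :: "('f \<Rightarrow> nat) \<Rightarrow> nat \<Rightarrow> ('f, nat) trm \<Rightarrow> bool" where
  "nary ar n t \<longleftrightarrow> wf_trm ar t \<and> vars t \<subseteq> {..<n}"

record ('f, 'a) alg =
  carrier :: "'a set"
  opn :: "'f \<Rightarrow> 'a list \<Rightarrow> 'a"

definition algebra :: "('f \<Rightarrow> nat) \<Rightarrow> ('f, 'a) alg \<Rightarrow> bool" where
  "algebra ar A \<longleftrightarrow> carrier A \<noteq> {} \<and>
     (\<forall>f xs. length xs = ar f \<and> set xs \<subseteq> carrier A \<longrightarrow> opn A f xs \<in> carrier A)"

fun eval :: "('f, 'a) alg \<Rightarrow> ('v \<Rightarrow> 'a) \<Rightarrow> ('f, 'v) trm \<Rightarrow> 'a" where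
  "eval A \<sigma> (Var v) = \<sigma> v"
| "eval A \<sigma> (App f ts) = opn A f (map (eval A \<sigma>) ts)"

text \<open>Homomorphisms are extensional, so that they are determined by their values on the carrier.\<close>

definition hom :: "('f \<Rightarrow> nat) \<Rightarrow> ('f, 'a) alg \<Rightarrow> ('f, 'b) alg \<Rightarrow> ('a \<Rightarrow> 'b) set" where
  "hom ar A B = {h \<in> carrier A \<rightarrow>\<^sub>E carrier B.
     \<forall>f xs. length xs = ar f \<and> set xs \<subseteq> carrier A \<longrightarrow> h (opn A f xs) = opn B f (map h xs)}"

definition iso :: "('f \<Rightarrow> nat) \<Rightarrow> ('f, 'a) alg \<Rightarrow> ('f, 'b) alg \<Rightarrow> bool" where
  "iso ar A B \<longleftrightarrow> (\<exists>h\<in>hom ar A B. bij_betw h (carrier A) (carrier B))"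

definition subuniverse :: "('f \<Rightarrow> nat) \<Rightarrow> ('f, 'a) alg \<Rightarrow> 'a set \<Rightarrow> bool" where
  "subuniverse ar A S \<longleftrightarrow> S \<subseteq> carrier A \<and> S \<noteq> {} \<and>
     (\<forall>f xs. length xs = ar f \<and> set xs \<subseteq> S \<longrightarrow> opn A f xs \<in> S)"

definition sub_alg :: "('f, 'a) alg \<Rightarrow> 'a set \<Rightarrow> ('f, 'a) alg" where
  "sub_alg A S = A\<lparr>carrier := S\<rparr>"

definition prod_alg :: "'i set \<Rightarrow> ('i \<Rightarrow> ('f, 'a) alg) \<Rightarrow> ('f, 'i \<Rightarrow> 'a) alg" where
  "prod_alg I N = \<lparr>carrier = (\<Pi>\<^sub>E i\<in>I. carrier (N i)),
                   opn = (\<lambda>f xs. \<lambda>i\<in>I. opn (N i) f (map (\<lambda>x. x i) xs))\<rparr>"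

definition pair_alg :: "('f, 'a) alg \<Rightarrow> ('f, 'b) alg \<Rightarrow> ('f, 'a \<times> 'b) alg" where
  "pair_alg A B = \<lparr>carrier = carrier A \<times> carrier B,
                   opn = (\<lambda>f xs. (opn A f (map fst xs), opn B f (map snd xs)))\<rparr>"

text \<open>The members of $\mathbb{ISP}(\mathfrak{M})$ carried by subsets of \<open>'b\<close>; the empty product is allowed.
  The index sets of the products are taken among the sets of pairs of elements of \<open>'b\<close>. This is no
  restriction, since for an embedding into an arbitrary product one coordinate separating each pair
  of distinct elements can be chosen; see \<open>ISP_iff_separated\<close> below.\<close>

definition ISP :: "('f \<Rightarrow> nat) \<Rightarrow> ('f, 'a) alg set \<Rightarrow> ('f, 'b) alg set" where
  "ISP ar \<MM> = {A. algebra ar A \<and>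
     (\<exists>(I :: ('b \<times> 'b) set) N S. (\<forall>i\<in>I. N i \<in> \<MM>) \<and>
        subuniverse ar (prod_alg I N) S \<and> iso ar A (sub_alg (prod_alg I N) S))}"


section \<open>Coproducts and free algebras\<close>

text \<open>The coproduct of the family \<open>(B i)\<close>, \<open>i \<in> K\<close>, in a class \<open>\<C>\<close> of algebras with carriers
  in a type \<open>'c\<close>; the members of the family may have carriers in another type. The universal
  property is tested on carriers in \<open>'c\<close> only, so \<open>'c\<close> has to be large enough for the family;
  the type \<open>univ\<close> below is.\<close>

definition is_coproduct ::
  "('f \<Rightarrow> nat) \<Rightarrow> ('f, 'c) alg set \<Rightarrow> 'i set \<Rightarrow> ('i \<Rightarrow> ('f, 'a) alg) \<Rightarrow>
   ('f, 'c) alg \<Rightarrow> ('i \<Rightarrow> 'a \<Rightarrow> 'c) \<Rightarrow> bool" where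
  "is_coproduct ar \<C> K B C \<epsilon> \<longleftrightarrow> C \<in> \<C> \<and> (\<forall>i\<in>K. \<epsilon> i \<in> hom ar (B i) C) \<and>
     (\<forall>D\<in>\<C>. \<forall>\<phi>. (\<forall>i\<in>K. \<phi> i \<in> hom ar (B i) D) \<longrightarrow>
        (\<exists>!h. h \<in> hom ar C D \<and> (\<forall>i\<in>K. \<forall>x\<in>carrier (B i). h (\<epsilon> i x) = \<phi> i x)))"

definition is_free1 :: "('f \<Rightarrow> nat) \<Rightarrow> ('f, 'a) alg set \<Rightarrow> ('f, 'a) alg \<Rightarrow> 'a \<Rightarrow> bool" where
  "is_free1 ar \<C> F x \<longleftrightarrow> F \<in> \<C> \<and> x \<in> carrier F \<and>
     (\<forall>D\<in>\<C>. \<forall>d\<in>carrier D. \<exists>!h. h \<in> hom ar F D \<and> h x = d)"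


section \<open>Bounded distributive lattices and the forgetful functor\<close>

datatype dop = Meet | Join | Zero | One

fun dar :: "dop \<Rightarrow> nat" where
  "dar Meet = 2" | "dar Join = 2" | "dar Zero = 0" | "dar One = 0"

definition bdlat :: "(dop, 'a) alg \<Rightarrow> bool" where
  "bdlat L \<longleftrightarrow> algebra dar L \<and>
     (let m = (\<lambda>x y. opn L Meet [x, y]); j = (\<lambda>x y. opn L Join [x, y]);
          z = opn L Zero []; e = opn L One [] in
      \<forall>x\<in>carrier L. \<forall>y\<in>carrier L. \<forall>w\<in>carrier L.
        m x y = m y x \<and> j x y = j y x \<and>
        m (m x y) w = m x (m y w) \<and> j (j x y) w = j x (j y w) \<and>
        m x (j x y) = x \<and> j x (m x y) = x \<and>
        m x (j y w) = j (m x y) (m x w) \<and>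
        j x z = x \<and> m x e = x)"

text \<open>The two-element lattice has carrier \<open>{False, True}\<close>; its order is the order \<open>\<le>\<close> of
  type \<open>bool\<close>.\<close>

definition two :: "(dop, bool) alg" where
  "two = \<lparr>carrier = UNIV, opn = (\<lambda>g xs. case g of
       Meet \<Rightarrow> xs ! 0 \<and> xs ! 1 | Join \<Rightarrow> xs ! 0 \<or> xs ! 1 | Zero \<Rightarrow> False | One \<Rightarrow> True)\<rparr>"

text \<open>The lattice operations are given by terms \<open>\<tau>\<close> of the language; the forgetful functor takes
  the corresponding term reduct, and is the identity on maps.\<close>

definition U :: "(dop \<Rightarrow> ('f, nat) trm) \<Rightarrow> ('f, 'a) alg \<Rightarrow> (dop, 'a) alg" where
  "U \<tau> A = \<lparr>carrier = carrier A, opn = (\<lambda>g xs. eval A (\<lambda>i. xs ! i) (\<tau> g))\<rparr>"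

definition D_based ::
  "('f \<Rightarrow> nat) \<Rightarrow> (dop \<Rightarrow> ('f, nat) trm) \<Rightarrow> ('f, 'a) alg set \<Rightarrow> bool" where
  "D_based ar \<tau> \<A> \<longleftrightarrow> (\<forall>g. nary ar (dar g) (\<tau> g)) \<and> (\<forall>A\<in>\<A>. bdlat (U \<tau> A))"

text \<open>The points of the Priestley dual; only the pointwise order on them is needed.\<close>

definition H :: "(dop, 'a) alg \<Rightarrow> ('a \<Rightarrow> bool) set" where
  "H L = hom dar L two"


section \<open>Separation and the relations $R_{\omega_1,\omega_2}$\<close>

text \<open>Subsets of the disjoint union of the \<open>H (U \<tau> M)\<close> are sets of pairs \<open>(M, \<omega>)\<close>.\<close>

definition Sep :: "('f \<Rightarrow> nat) \<Rightarrow> ('f, 'a) alg set \<Rightarrow> (('f, 'a) alg \<times> ('a \<Rightarrow> bool)) set \<Rightarrow> bool" where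
  "Sep ar \<MM> \<Omega> \<longleftrightarrow> (\<forall>M\<in>\<MM>. \<forall>a\<in>carrier M. \<forall>b\<in>carrier M. a \<noteq> b \<longrightarrow>
     (\<exists>M'\<in>\<MM>. \<exists>u\<in>hom ar M M'. \<exists>\<omega>. (M', \<omega>) \<in> \<Omega> \<and> \<omega> (u a) \<noteq> \<omega> (u b)))"

text \<open>Over finite algebras the sets \<open>Rset ar p q\<close> are finite, so \<open>card\<close> is their true size.\<close>

definition le_preimage ::
  "('f, 'a) alg \<times> ('a \<Rightarrow> bool) \<Rightarrow> ('f, 'b) alg \<times> ('b \<Rightarrow> bool) \<Rightarrow> ('a \<times> 'b) set" where
  "le_preimage p q =
     {(a, b). a \<in> carrier (fst p) \<and> b \<in> carrier (fst q) \<and> snd p a \<le> snd q b}"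

definition Rset ::
  "('f \<Rightarrow> nat) \<Rightarrow> ('f, 'a) alg \<times> ('a \<Rightarrow> bool) \<Rightarrow> ('f, 'b) alg \<times> ('b \<Rightarrow> bool) \<Rightarrow> ('a \<times> 'b) set set"
  where
  "Rset ar p q =
     {S. subuniverse ar (pair_alg (fst p) (fst q)) S \<and> S \<subseteq> le_preimage p q \<and>
         (\<forall>T. subuniverse ar (pair_alg (fst p) (fst q)) T \<and> T \<subseteq> le_preimage p q \<and> S \<subseteq> T
            \<longrightarrow> T = S)}"


section \<open>The comparison maps\<close>

text \<open>A type for the carriers of the coproducts, in \<open>\<A>\<close> and in the class of bounded
  distributive lattices, of a set of algebras with carriers in \<open>'a\<close>: terms in both languages over
  the disjoint union of all algebras with carriers in \<open>'a\<close>. Every such coproduct is generated by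
  the images of its cocone and hence is, up to isomorphism, carried by a set of such terms; existence
  is shown in \<open>coproduct_exists_ISP\<close> and \<open>coproduct_exists_bdlat\<close>. Moreover, in an algebra
  carried by any type, the subalgebra generated by a cocone has a copy carried by \<open>univ\<close>, so testing
  the universal property inside \<open>univ\<close> suffices.\<close>

type_synonym ('f, 'a) univ = "('f + dop, ('f, 'a) alg \<times> 'a) trm"

definition coprod_A ::
  "('f \<Rightarrow> nat) \<Rightarrow> ('f, 'a) alg set \<Rightarrow> ('f, 'a) alg set \<Rightarrow>
   ('f, ('f, 'a) univ) alg \<Rightarrow> (('f, 'a) alg \<Rightarrow> 'a \<Rightarrow> ('f, 'a) univ) \<Rightarrow> bool" where
  "coprod_A ar \<MM> K C \<epsilon> \<longleftrightarrow> is_coproduct ar (ISP ar \<MM>) K (\<lambda>B. B) C \<epsilon>"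

definition coprod_D ::
  "(dop \<Rightarrow> ('f, nat) trm) \<Rightarrow> ('f, 'a) alg set \<Rightarrow>
   (dop, ('f, 'a) univ) alg \<Rightarrow> (('f, 'a) alg \<Rightarrow> 'a \<Rightarrow> ('f, 'a) univ) \<Rightarrow> bool" where
  "coprod_D \<tau> K P \<delta> \<longleftrightarrow> is_coproduct dar {L. bdlat L} K (U \<tau>) P \<delta>"

definition chi ::
  "(dop \<Rightarrow> ('f, nat) trm) \<Rightarrow> ('f, 'a) alg set \<Rightarrow> (dop, 'c) alg \<Rightarrow> (('f, 'a) alg \<Rightarrow> 'a \<Rightarrow> 'c) \<Rightarrow>
   ('f, 'd) alg \<Rightarrow> (('f, 'a) alg \<Rightarrow> 'a \<Rightarrow> 'd) \<Rightarrow> 'c \<Rightarrow> 'd" where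
  "chi \<tau> K P \<delta> C \<epsilon> = (THE h. h \<in> hom dar P (U \<tau> C) \<and>
     (\<forall>B\<in>K. \<forall>x\<in>carrier B. h (\<delta> B x) = \<epsilon> B x))"

definition chi_onto ::
  "('f \<Rightarrow> nat) \<Rightarrow> (dop \<Rightarrow> ('f, nat) trm) \<Rightarrow> ('f, 'a) alg set \<Rightarrow> ('f, 'a) alg set \<Rightarrow> bool" where
  "chi_onto ar \<tau> \<MM> K \<longleftrightarrow> (\<forall>C \<epsilon> P \<delta>. coprod_A ar \<MM> K C \<epsilon> \<and> coprod_D \<tau> K P \<delta> \<longrightarrow>
     chi \<tau> K P \<delta> C \<epsilon> ` carrier P = carrier (U \<tau> C))"

definition iota ::
  "('f, 'a) alg set \<Rightarrow> (('f, 'a) alg \<Rightarrow> 'a \<Rightarrow> 'c) \<Rightarrow> ('c \<Rightarrow> bool) \<Rightarrow> ('f, 'a) alg \<Rightarrow> 'a \<Rightarrow> bool" where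
  "iota K \<epsilon> y = (\<lambda>B\<in>K. \<lambda>x\<in>carrier B. y (\<epsilon> B x))"

definition iota_embedding ::
  "('f \<Rightarrow> nat) \<Rightarrow> (dop \<Rightarrow> ('f, nat) trm) \<Rightarrow> ('f, 'a) alg set \<Rightarrow> ('f, 'a) alg set \<Rightarrow> bool" where
  "iota_embedding ar \<tau> \<MM> K \<longleftrightarrow> (\<forall>C \<epsilon>. coprod_A ar \<MM> K C \<epsilon> \<longrightarrow>
     (\<forall>y\<in>H (U \<tau> C). \<forall>z\<in>H (U \<tau> C).
        (\<forall>B\<in>K. \<forall>x\<in>carrier B. iota K \<epsilon> y B x \<le> iota K \<epsilon> z B x) \<longleftrightarrow>
        (\<forall>c\<in>carrier C. y c \<le> z c)))"


section \<open>The conditions\<close>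

text \<open>Algebras range over those with carriers in \<open>'a\<close>. In the conditions on coproducts the set
  \<open>K\<close> is nonempty: for bounded distributive lattices with an additional constant \<open>c\<close>, generated
  by the chain \<open>0 < c < 1\<close>, the empty coproduct \<open>{0, 1}\<close> of lattices does not map onto the initial
  algebra \<open>{0, c, 1}\<close>, although all subalgebras contain \<open>c\<close> and every \<open>L\<close> containing a subalgebra
  is one.\<close>

definition preserves_coproducts ::
  "('f \<Rightarrow> nat) \<Rightarrow> (dop \<Rightarrow> ('f, nat) trm) \<Rightarrow> ('f, 'a) alg set \<Rightarrow> bool" where
  "preserves_coproducts ar \<tau> \<MM> \<longleftrightarrow>
     (\<forall>K. K \<noteq> {} \<and> K \<subseteq> ISP ar \<MM> \<longrightarrow> chi_onto ar \<tau> \<MM> K)"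

definition preserves_free_coproducts ::
  "('f \<Rightarrow> nat) \<Rightarrow> (dop \<Rightarrow> ('f, nat) trm) \<Rightarrow> ('f, 'a) alg set \<Rightarrow> bool" where
  "preserves_free_coproducts ar \<tau> \<MM> \<longleftrightarrow>
     (\<forall>(F :: ('f, 'a) alg) g K. is_free1 ar (ISP ar \<MM>) F g \<and> K \<noteq> {} \<and> finite K \<and>
        (\<forall>B\<in>K. algebra ar B \<and> iso ar F B) \<and>
        (\<forall>B\<in>K. \<forall>B'\<in>K. B \<noteq> B' \<longrightarrow> carrier B \<inter> carrier B' = {}) \<longrightarrow>
        chi_onto ar \<tau> \<MM> K)"

text \<open>A term \<open>t\<close> in \<open>a 0, \<dots>, a (n - 1)\<close> is a lattice term applied to finitely many unary terms,
  each evaluated at one of the \<open>a i\<close>. More than one unary term per variable may be needed: in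
  Boolean algebras symmetric difference is \<open>(x \<and> \<not> y) \<or> (\<not> x \<and> y)\<close>, but it is not of the form
  \<open>s (t\<^sub>1 x) (t\<^sub>2 y)\<close> for a binary lattice term \<open>s\<close>.\<close>

definition unary_decomposition ::
  "('f \<Rightarrow> nat) \<Rightarrow> (dop \<Rightarrow> ('f, nat) trm) \<Rightarrow> ('f, 'a) alg set \<Rightarrow> bool" where
  "unary_decomposition ar \<tau> \<MM> \<longleftrightarrow>
     (\<forall>n\<ge>1. \<forall>t. nary ar n t \<longrightarrow>
        (\<exists>m ts ix s. (\<forall>j<m. nary ar 1 (ts j) \<and> ix j < n) \<and> nary dar m s \<and>
           (\<forall>A\<in>ISP ar \<MM>. \<forall>a. (\<forall>i<n. a i \<in> carrier (A :: ('f, 'a) alg)) \<longrightarrow>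
              eval A a t = eval (U \<tau> A) (\<lambda>j. eval A (\<lambda>_. a (ix j)) (ts j)) s)))"

definition sublattices_have_top_subalgebra ::
  "('f \<Rightarrow> nat) \<Rightarrow> (dop \<Rightarrow> ('f, nat) trm) \<Rightarrow> ('f, 'a) alg set \<Rightarrow> bool" where
  "sublattices_have_top_subalgebra ar \<tau> \<MM> \<longleftrightarrow>
     (\<forall>A\<in>ISP ar \<MM>. \<forall>L. subuniverse dar (U \<tau> (A :: ('f, 'a) alg)) L \<longrightarrow>
        \<not> (\<exists>B. subuniverse ar A B \<and> B \<subseteq> L) \<or>
        (\<exists>T. subuniverse ar A T \<and> T \<subseteq> L \<and> (\<forall>B. subuniverse ar A B \<and> B \<subseteq> L \<longrightarrow> B \<subseteq> T)))"

definition iotas_order_embeddings ::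
  "('f \<Rightarrow> nat) \<Rightarrow> (dop \<Rightarrow> ('f, nat) trm) \<Rightarrow> ('f, 'a) alg set \<Rightarrow> bool" where
  "iotas_order_embeddings ar \<tau> \<MM> \<longleftrightarrow>
     (\<forall>K. K \<noteq> {} \<and> K \<subseteq> ISP ar \<MM> \<longrightarrow> iota_embedding ar \<tau> \<MM> K)"


section \<open>Separation in $\mathbb{ISP}$ and existence of coproducts\<close>

lemma homD:
  assumes "h \<in> hom ar A B"
  shows "x \<in> carrier A \<Longrightarrow> h x \<in> carrier B"
    and "length xs = ar f \<Longrightarrow> set xs \<subseteq> carrier A \<Longrightarrow> h (opn A f xs) = opn B f (map h xs)"
    and "x \<notin> carrier A \<Longrightarrow> h x = undefined"
  using assms by (auto simp: hom_def)

lemma homI: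
  assumes "\<And>x. x \<in> carrier A \<Longrightarrow> h x \<in> carrier B" "\<And>x. x \<notin> carrier A \<Longrightarrow> h x = undefined"
    and "\<And>f xs. length xs = ar f \<Longrightarrow> set xs \<subseteq> carrier A \<Longrightarrow> h (opn A f xs) = opn B f (map h xs)"
  shows "h \<in> hom ar A B"
  using assms by (auto simp: hom_def)

lemma restrict_homI:
  assumes "algebra ar A" "\<And>x. x \<in> carrier A \<Longrightarrow> h x \<in> carrier B"
    and "\<And>f xs. length xs = ar f \<Longrightarrow> set xs \<subseteq> carrier A \<Longrightarrow> h (opn A f xs) = opn B f (map h xs)"
  shows "restrict h (carrier A) \<in> hom ar A B"
proof (rule homI)
  fix f xs
  assume *: "length xs = ar f" "set xs \<subseteq> carrier A"
  then have m: "map (restrict h (carrier A)) xs = map h xs"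
    by (intro map_cong) auto
  have "opn A f xs \<in> carrier A" using * assms(1) by (simp add: algebra_def)
  then show "restrict h (carrier A) (opn A f xs) = opn B f (map (restrict h (carrier A)) xs)"
    unfolding m using assms(3)[OF *] by simp
qed (use assms in auto)

lemma eval_closed:
  assumes "algebra ar A" "wf_trm ar t" "\<And>v. v \<in> vars t \<Longrightarrow> \<sigma> v \<in> carrier A"
  shows "eval A \<sigma> t \<in> carrier A"
  using assms(2,3)
proof (induction t)
  case (App f ts)
  then have "set (map (eval A \<sigma>) ts) \<subseteq> carrier A" by auto
  with App.prems assms(1) show ?case by (simp add: algebra_def)
qed simp

lemma eval_hom:
  assumes "algebra ar A" "h \<in> hom ar A B" "wf_trm ar t" "\<And>v. v \<in> vars t \<Longrightarrow> \<sigma> v \<in> carrier A"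
  shows "h (eval A \<sigma> t) = eval B (\<lambda>v. h (\<sigma> v)) t"
  using assms(3,4)
proof (induction t)
  case (App f ts)
  have "eval A \<sigma> t \<in> carrier A" if "t \<in> set ts" for t
    using that App.prems by (intro eval_closed[OF assms(1)]) auto
  then have "set (map (eval A \<sigma>) ts) \<subseteq> carrier A" by auto
  with App.prems have "h (eval A \<sigma> (App f ts)) = opn B f (map h (map (eval A \<sigma>) ts))"
    by (simp add: homD(2)[OF assms(2)])
  also have "map h (map (eval A \<sigma>) ts) = map (eval B (\<lambda>v. h (\<sigma> v))) ts"
    using App by auto
  finally show ?case by simp
qed simp

lemma ISP_iff_separated:
  fixes A :: "('f, 'b) alg"
  assumes "\<And>M. M \<in> \<MM> \<Longrightarrow> algebra ar M"
  shows "A \<in> ISP ar \<MM> \<longleftrightarrow> algebra ar A \<and>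
    (\<forall>x\<in>carrier A. \<forall>y\<in>carrier A. x \<noteq> y \<longrightarrow> (\<exists>M\<in>\<MM>. \<exists>h\<in>hom ar A M. h x \<noteq> h y))"
proof
  assume "A \<in> ISP ar \<MM>"
  then obtain I :: "('b \<times> 'b) set" and N S e where A: "algebra ar A" and N: "\<forall>i\<in>I. N i \<in> \<MM>"
    and S: "subuniverse ar (prod_alg I N) S"
    and e: "e \<in> hom ar A (sub_alg (prod_alg I N) S)" "bij_betw e (carrier A) S"
    by (auto simp: ISP_def iso_def sub_alg_def)
  have eS: "e x \<in> (\<Pi>\<^sub>E i\<in>I. carrier (N i))" if "x \<in> carrier A" for x
    using homD(1)[OF e(1) that] S by (auto simp: sub_alg_def subuniverse_def prod_alg_def)
  have "\<exists>M\<in>\<MM>. \<exists>h\<in>hom ar A M. h x \<noteq> h y"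
    if xy: "x \<in> carrier A" "y \<in> carrier A" "x \<noteq> y" for x y
  proof -
    have "e x \<noteq> e y" using xy e(2) by (auto simp: bij_betw_def inj_on_def)
    then obtain i where i: "i \<in> I" "e x i \<noteq> e y i"
      using eS[OF xy(1)] eS[OF xy(2)] by (metis PiE_ext)
    have "restrict (\<lambda>x. e x i) (carrier A) \<in> hom ar A (N i)"
    proof (rule restrict_homI[OF A])
      show "e x i \<in> carrier (N i)" if "x \<in> carrier A" for x
        using eS[OF that] i(1) by auto
      show "e (opn A f xs) i = opn (N i) f (map (\<lambda>x. e x i) xs)"
        if "length xs = ar f" "set xs \<subseteq> carrier A" for f xs
        using homD(2)[OF e(1) that] i(1) by (simp add: sub_alg_def prod_alg_def comp_def)
    qed
    moreover have "restrict (\<lambda>x. e x i) (carrier A) x \<noteq> restrict (\<lambda>x. e x i) (carrier A) y"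
      using xy i by simp
    ultimately show ?thesis using N i(1) by blast
  qed
  with A show "algebra ar A \<and> (\<forall>x\<in>carrier A. \<forall>y\<in>carrier A. x \<noteq> y \<longrightarrow>
      (\<exists>M\<in>\<MM>. \<exists>h\<in>hom ar A M. h x \<noteq> h y))" by blast
next
  assume R: "algebra ar A \<and> (\<forall>x\<in>carrier A. \<forall>y\<in>carrier A. x \<noteq> y \<longrightarrow>
    (\<exists>M\<in>\<MM>. \<exists>h\<in>hom ar A M. h x \<noteq> h y))"
  then have A: "algebra ar A" ..
  define I where "I = {p. fst p \<in> carrier A \<and> snd p \<in> carrier A \<and> fst p \<noteq> snd p}"
  have "\<forall>p\<in>I. \<exists>M h. M \<in> \<MM> \<and> h \<in> hom ar A M \<and> h (fst p) \<noteq> h (snd p)"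
    using R unfolding I_def by blast
  then obtain N h where Nh: "\<And>p. p \<in> I \<Longrightarrow> N p \<in> \<MM> \<and> h p \<in> hom ar A (N p) \<and> h p (fst p) \<noteq> h p (snd p)"
    by metis
  define e where "e = (\<lambda>x. \<lambda>p\<in>I. h p x)"
  have e_op: "e (opn A f xs) = opn (prod_alg I N) f (map e xs)"
    if "length xs = ar f" "set xs \<subseteq> carrier A" for f xs
  proof
    fix p
    show "e (opn A f xs) p = opn (prod_alg I N) f (map e xs) p"
    proof (cases "p \<in> I")
      case True
      with that Nh[OF True] have "h p (opn A f xs) = opn (N p) f (map (h p) xs)"
        by (auto intro: homD(2))
      with True show ?thesis by (simp add: e_def prod_alg_def comp_def)
    qed (simp add: e_def prod_alg_def)
  qed
  have e_in: "e x \<in> carrier (prod_alg I N)" if "x \<in> carrier A" for x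
    using that Nh by (auto simp: e_def prod_alg_def intro: homD(1))
  have S: "subuniverse ar (prod_alg I N) (e ` carrier A)"
    unfolding subuniverse_def
  proof (intro conjI allI impI)
    show "e ` carrier A \<noteq> {}" using A by (simp add: algebra_def)
    fix f xs
    assume *: "length xs = ar f \<and> set xs \<subseteq> e ` carrier A"
    then have "xs \<in> map e ` lists (carrier A)" unfolding lists_image[symmetric] by auto
    then obtain ys where ys: "xs = map e ys" "set ys \<subseteq> carrier A" by auto
    with * have "opn (prod_alg I N) f xs = e (opn A f ys)" by (simp add: e_op)
    moreover have "opn A f ys \<in> carrier A" using A ys * by (simp add: algebra_def)
    ultimately show "opn (prod_alg I N) f xs \<in> e ` carrier A" by blast
  qed (use e_in in auto)
  have "inj_on e (carrier A)"
  proof (rule inj_onI, rule ccontr)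
    fix x y assume "x \<in> carrier A" "y \<in> carrier A" "e x = e y" "x \<noteq> y"
    then have "(x, y) \<in> I" by (simp add: I_def)
    with \<open>e x = e y\<close> Nh[OF this] show False by (auto simp: e_def dest: fun_cong[where x = "(x, y)"])
  qed
  then have "bij_betw (restrict e (carrier A)) (carrier A) (e ` carrier A)"
    by (simp add: bij_betw_def inj_on_def)
  moreover have "restrict e (carrier A) \<in> hom ar A (sub_alg (prod_alg I N) (e ` carrier A))"
    by (rule restrict_homI[OF A]) (auto simp: sub_alg_def e_op)
  ultimately have "iso ar A (sub_alg (prod_alg I N) (e ` carrier A))"
    unfolding iso_def by (intro bexI[of _ "restrict e (carrier A)"]) (simp_all add: sub_alg_def)
  with A S Nh show "A \<in> ISP ar \<MM>" unfolding ISP_def by blast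
qed

lemma coproduct_exists:
  fixes j :: "('f, 'i \<times> 'a) trm \<Rightarrow> 'c" and \<C> :: "('f, 'c) alg set" and B :: "'i \<Rightarrow> ('f, 'a) alg"
  assumes j: "inj j" and K: "K \<noteq> {}" "\<And>i. i \<in> K \<Longrightarrow> algebra ar (B i)"
    and alg: "\<And>D. D \<in> \<C> \<Longrightarrow> algebra ar D"
    and sep: "\<And>C. algebra ar C \<Longrightarrow> (\<And>x y. x \<in> carrier C \<Longrightarrow> y \<in> carrier C \<Longrightarrow> x \<noteq> y \<Longrightarrow>
        \<exists>D\<in>\<C>. \<exists>h\<in>hom ar C D. h x \<noteq> h y) \<Longrightarrow> C \<in> \<C>"
  shows "\<exists>C \<epsilon>. is_coproduct ar \<C> K B C \<epsilon>"
proof -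
  define V where "V = {t. wf_trm ar t \<and> vars t \<subseteq> (SIGMA i:K. carrier (B i))}"
  define coc where "coc = (\<lambda>D \<phi>. D \<in> \<C> \<and> (\<forall>i\<in>K. \<phi> i \<in> hom ar (B i) D))"
  define ev where "ev = (\<lambda>(D :: ('f, 'c) alg) (\<phi> :: 'i \<Rightarrow> 'a \<Rightarrow> 'c). eval D (\<lambda>p. \<phi> (fst p) (snd p)))"
  define eqv where "eqv = (\<lambda>s t. s \<in> V \<and> t \<in> V \<and> (\<forall>D \<phi>. coc D \<phi> \<longrightarrow> ev D \<phi> s = ev D \<phi> t))"
  define r where "r = (\<lambda>t. SOME s. eqv s t)"
  have r: "eqv (r t) t" if "t \<in> V" for t
    unfolding r_def by (rule someI[of _ t]) (use that in \<open>auto simp: eqv_def\<close>)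
  have r_cong: "r s = r t" if "eqv s t" for s t
  proof -
    from that have "(\<lambda>u. eqv u s) = (\<lambda>u. eqv u t)" by (auto simp: eqv_def fun_eq_iff)
    then show ?thesis by (simp add: r_def)
  qed
  have rV: "r t \<in> V" if "t \<in> V" for t using r[OF that] by (simp add: eqv_def)
  have ev_r: "ev D \<phi> (r t) = ev D \<phi> t" if "t \<in> V" "coc D \<phi>" for D \<phi> t
    using r[OF that(1)] that(2) by (simp add: eqv_def)
  have evV: "ev D \<phi> t \<in> carrier D" if "t \<in> V" "coc D \<phi>" for D \<phi> t
    unfolding ev_def
  proof (rule eval_closed[where ar = ar])
    show "algebra ar D" "wf_trm ar t" using that alg by (auto simp: V_def coc_def)
    show "\<phi> (fst v) (snd v) \<in> carrier D" if "v \<in> vars t" for v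
    proof -
      have "v \<in> (SIGMA i:K. carrier (B i))" using that \<open>t \<in> V\<close> unfolding V_def by blast
      then have "fst v \<in> K" "snd v \<in> carrier (B (fst v))" by auto
      moreover from this \<open>coc D \<phi>\<close> have "\<phi> (fst v) \<in> hom ar (B (fst v)) D" by (simp add: coc_def)
      ultimately show ?thesis by (simp add: homD(1))
    qed
  qed
  have AppV: "App f ts \<in> V" if "length ts = ar f" "set ts \<subseteq> V" for f ts
    using that by (fastforce simp: V_def)
  define q where "q = (\<lambda>t. j (r t))"
  define un where "un = (\<lambda>x. r (inv j x))"
  have un_q: "un (q t) = r t" if "t \<in> V" for t
    unfolding un_def q_def using j r_cong[OF r[OF that]] by simp
  define C :: "('f, 'c) alg" where
    "C = \<lparr>carrier = q ` V, opn = (\<lambda>f xs. q (App f (map un xs)))\<rparr>"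
  have unV: "un x \<in> V" if "x \<in> carrier C" for x
    using that un_q rV by (auto simp: C_def)
  have q_un: "q (un x) = x" if "x \<in> carrier C" for x
  proof -
    obtain t where t: "t \<in> V" "x = q t" using \<open>x \<in> carrier C\<close> by (auto simp: C_def)
    with un_q r_cong[OF r[OF t(1)]] show ?thesis by (simp add: q_def)
  qed
  have mapV: "set (map un xs) \<subseteq> V" if "set xs \<subseteq> carrier C" for xs
    unfolding set_map using that unV by blast
  have algC: "algebra ar C"
    unfolding algebra_def
  proof (intro conjI allI impI)
    obtain i where i: "i \<in> K" using K(1) by blast
    then obtain b where "b \<in> carrier (B i)" using K(2)[OF i] by (auto simp: algebra_def)
    with i have "Var (i, b) \<in> V" by (simp add: V_def)
    then show "carrier C \<noteq> {}" by (auto simp: C_def)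
    fix f xs assume "length xs = ar f \<and> set xs \<subseteq> carrier C"
    then have "App f (map un xs) \<in> V" by (intro AppV mapV) simp_all
    then show "opn C f xs \<in> carrier C" by (simp add: C_def)
  qed
  define ind where "ind = (\<lambda>D \<phi>. restrict (\<lambda>x. ev D \<phi> (un x)) (carrier C))"
  have ind_q: "ind D \<phi> (q t) = ev D \<phi> t" if "t \<in> V" "coc D \<phi>" for D \<phi> t
    using that by (simp add: ind_def un_q ev_r) (simp add: C_def)
  have ind_hom: "ind D \<phi> \<in> hom ar C D" if c: "coc D \<phi>" for D \<phi>
    unfolding ind_def
  proof (rule restrict_homI[OF algC])
    show "ev D \<phi> (un x) \<in> carrier D" if "x \<in> carrier C" for x
      using evV[OF unV[OF that] c] .
    fix f xs assume *: "length xs = ar f" "set xs \<subseteq> carrier C"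
    then have A: "App f (map un xs) \<in> V" by (intro AppV mapV) simp_all
    show "ev D \<phi> (un (opn C f xs)) = opn D f (map (\<lambda>x. ev D \<phi> (un x)) xs)"
      using ev_r[OF A c] un_q[OF A] by (simp add: C_def ev_def comp_def)
  qed
  have "C \<in> \<C>"
  proof (rule sep[OF algC])
    fix x y assume xy: "x \<in> carrier C" "y \<in> carrier C" "x \<noteq> y"
    then obtain s t where st: "s \<in> V" "t \<in> V" "x = q s" "y = q t" by (auto simp: C_def)
    with xy(3) r_cong have "\<not> eqv s t" by (auto simp: q_def)
    then obtain D \<phi> where "coc D \<phi>" "ev D \<phi> s \<noteq> ev D \<phi> t" using st by (auto simp: eqv_def)
    then show "\<exists>D\<in>\<C>. \<exists>h\<in>hom ar C D. h x \<noteq> h y"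
      using st ind_q ind_hom by (metis coc_def)
  qed
  define \<epsilon> where "\<epsilon> = (\<lambda>i. restrict (\<lambda>b. q (Var (i, b))) (carrier (B i)))"
  have VarV: "Var (i, b) \<in> V" if "i \<in> K" "b \<in> carrier (B i)" for i b
    using that by (simp add: V_def)
  have eps: "\<epsilon> i \<in> hom ar (B i) C" if i: "i \<in> K" for i
    unfolding \<epsilon>_def
  proof (rule restrict_homI)
    show "algebra ar (B i)" using K(2) i .
    show "q (Var (i, b)) \<in> carrier C" if "b \<in> carrier (B i)" for b
      using VarV[OF i that] by (auto simp: C_def)
    fix f xs assume *: "length xs = ar f" "set xs \<subseteq> carrier (B i)"
    then have o: "opn (B i) f xs \<in> carrier (B i)" using K(2)[OF i] by (simp add: algebra_def)
    let ?ts = "map (\<lambda>b. un (q (Var (i, b)))) xs"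
    have ts: "set ?ts \<subseteq> V" using * VarV[OF i] un_q rV by auto
    have A: "App f ?ts \<in> V" by (rule AppV[OF _ ts]) (use * in simp)
    have "eqv (Var (i, opn (B i) f xs)) (App f ?ts)"
      unfolding eqv_def
    proof (intro conjI allI impI)
      show "Var (i, opn (B i) f xs) \<in> V" using VarV[OF i o] .
      show "App f ?ts \<in> V" by (rule A)
      fix D \<phi> assume c: "coc D \<phi>"
      have "map (ev D \<phi>) ?ts = map (\<phi> i) xs"
      proof -
        have "ev D \<phi> (un (q (Var (i, b)))) = \<phi> i b" if "b \<in> set xs" for b
        proof -
          have "b \<in> carrier (B i)" using that *(2) by blast
          then have "ev D \<phi> (un (q (Var (i, b)))) = ev D \<phi> (Var (i, b))"
            using VarV[OF i] un_q ev_r c by simp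
          then show ?thesis by (simp add: ev_def)
        qed
        then show ?thesis by simp
      qed
      moreover have "\<phi> i (opn (B i) f xs) = opn D f (map (\<phi> i) xs)"
        using c i * by (intro homD(2)[where ar = ar]) (auto simp: coc_def)
      moreover have "ev D \<phi> (App f ?ts) = opn D f (map (ev D \<phi>) ?ts)"
        by (simp add: ev_def)
      ultimately show "ev D \<phi> (Var (i, opn (B i) f xs)) = ev D \<phi> (App f ?ts)"
        by (simp add: ev_def del: map_map)
    qed
    from r_cong[OF this] show "q (Var (i, opn (B i) f xs)) = opn C f (map (\<lambda>b. q (Var (i, b))) xs)"
      by (simp add: C_def q_def comp_def)
  qed
  have gen: "h (q t) = ev D \<phi> t"
    if h: "h \<in> hom ar C D" "\<forall>i\<in>K. \<forall>x\<in>carrier (B i). h (\<epsilon> i x) = \<phi> i x" and c: "coc D \<phi>" and t: "t \<in> V"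
    for h D \<phi> t
    using t
  proof (induction t)
    case (Var p)
    obtain i b where p: "p = (i, b)" by (cases p)
    with Var have "i \<in> K" "b \<in> carrier (B i)" by (simp_all add: V_def)
    moreover from this h(2) have "h (\<epsilon> i b) = \<phi> i b" by blast
    ultimately show ?case by (simp add: p \<epsilon>_def ev_def)
  next
    case (App f ts)
    have ts: "set ts \<subseteq> V" "length ts = ar f" using App.prems unfolding V_def by auto
    have qs: "set (map q ts) \<subseteq> carrier C" using ts by (auto simp: C_def)
    have us: "map un (map q ts) = map r ts" using ts un_q by auto
    have "eqv (App f (map r ts)) (App f ts)"
      unfolding eqv_def
    proof (intro conjI allI impI)
      show "App f (map r ts) \<in> V" using ts rV by (intro AppV) auto
      show "App f ts \<in> V" using App.prems .
      fix D \<phi> assume "coc D \<phi>"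
      then have "map (ev D \<phi>) (map r ts) = map (ev D \<phi>) ts" using ts ev_r by auto
      then show "ev D \<phi> (App f (map r ts)) = ev D \<phi> (App f ts)"
        by (simp add: ev_def del: map_map map_eq_conv)
    qed
    from r_cong[OF this] have "q (App f ts) = q (App f (map r ts))" by (simp add: q_def)
    also have "\<dots> = opn C f (map q ts)" unfolding us[symmetric] by (simp add: C_def)
    finally have "q (App f ts) = opn C f (map q ts)" .
    then have "h (q (App f ts)) = opn D f (map h (map q ts))"
      using homD(2)[OF h(1) _ qs] ts(2) by (simp del: map_map)
    also have "map h (map q ts) = map (ev D \<phi>) ts"
      unfolding map_map comp_def using App.IH ts(1) by (intro map_cong) blast+
    finally show ?case by (simp add: ev_def)
  qed
  have "is_coproduct ar \<C> K B C \<epsilon>"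
    unfolding is_coproduct_def
  proof (intro conjI ballI allI impI)
    fix D \<phi> assume "D \<in> \<C>" "\<forall>i\<in>K. \<phi> i \<in> hom ar (B i) D"
    then have c: "coc D \<phi>" by (simp add: coc_def)
    show "\<exists>!h. h \<in> hom ar C D \<and> (\<forall>i\<in>K. \<forall>x\<in>carrier (B i). h (\<epsilon> i x) = \<phi> i x)"
    proof (rule ex1I[of _ "ind D \<phi>"])
      show "ind D \<phi> \<in> hom ar C D \<and> (\<forall>i\<in>K. \<forall>x\<in>carrier (B i). ind D \<phi> (\<epsilon> i x) = \<phi> i x)"
        using ind_hom[OF c] by (simp add: \<epsilon>_def ind_q[OF VarV c]) (simp add: ev_def)
      fix h assume h: "h \<in> hom ar C D \<and> (\<forall>i\<in>K. \<forall>x\<in>carrier (B i). h (\<epsilon> i x) = \<phi> i x)"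
      show "h = ind D \<phi>"
      proof
        fix x show "h x = ind D \<phi> x"
        proof (cases "x \<in> carrier C")
          case True
          then obtain t where "t \<in> V" "x = q t" by (auto simp: C_def)
          then show ?thesis using gen[OF conjunct1[OF h] conjunct2[OF h] c] ind_q[OF _ c] by simp
        next
          case False
          then show ?thesis using homD(3)[OF conjunct1[OF h]] by (simp add: ind_def)
        qed
      qed
    qed
  qed (use \<open>C \<in> \<C>\<close> eps in auto)
  then show ?thesis by blast
qed

lemma coproduct_exists_ISP:
  fixes \<MM> :: "('f, 'a) alg set"
  assumes "\<And>M. M \<in> \<MM> \<Longrightarrow> algebra ar M" "K \<noteq> {}" "K \<subseteq> ISP ar \<MM>"
  shows "\<exists>C \<epsilon>. coprod_A ar \<MM> K C \<epsilon>"
  unfolding coprod_A_def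
proof (rule coproduct_exists[where j = "map_trm Inl (\<lambda>p. p)"])
  show "inj (map_trm Inl (\<lambda>p. p) :: ('f, ('f, 'a) alg \<times> 'a) trm \<Rightarrow> ('f, 'a) univ)"
    by (rule trm.inj_map) auto
  show "algebra ar B" if "B \<in> K" for B using that assms(3) by (auto simp: ISP_def)
  fix C :: "('f, ('f, 'a) univ) alg"
  assume C: "algebra ar C" "\<And>x y. x \<in> carrier C \<Longrightarrow> y \<in> carrier C \<Longrightarrow> x \<noteq> y \<Longrightarrow>
    \<exists>D\<in>ISP ar \<MM>. \<exists>h\<in>hom ar C (D :: ('f, ('f, 'a) univ) alg). h x \<noteq> h y"
  have "\<exists>M\<in>\<MM>. \<exists>h\<in>hom ar C M. h x \<noteq> h y"
    if xy: "x \<in> carrier C" "y \<in> carrier C" "x \<noteq> y" for x y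
  proof -
    obtain D :: "('f, ('f, 'a) univ) alg" and h where
      D: "D \<in> ISP ar \<MM>" and h: "h \<in> hom ar C D" "h x \<noteq> h y" using C(2)[OF xy] by blast
    then obtain M k where M: "M \<in> \<MM>" and k: "k \<in> hom ar D M" "k (h x) \<noteq> k (h y)"
      using ISP_iff_separated[where A = D, OF assms(1)] homD(1)[OF h(1)] xy by blast
    have "restrict (\<lambda>x. k (h x)) (carrier C) \<in> hom ar C M"
    proof (rule restrict_homI[OF C(1)])
      show "k (h x) \<in> carrier M" if "x \<in> carrier C" for x
        using homD(1)[OF k(1) homD(1)[OF h(1) that]] .
      fix f xs assume *: "length xs = ar f" "set xs \<subseteq> carrier C"
      then have "set (map h xs) \<subseteq> carrier D" using homD(1)[OF h(1)] by auto
      with * show "k (h (opn C f xs)) = opn M f (map (\<lambda>x. k (h x)) xs)"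
        by (simp add: homD(2)[OF h(1)] homD(2)[OF k(1)] comp_def)
    qed
    with M k(2) xy show ?thesis by (metis restrict_apply')
  qed
  with C(1) show "C \<in> ISP ar \<MM>" using ISP_iff_separated[where A = C, OF assms(1)] by blast
qed (use assms(2) in \<open>auto simp: ISP_def\<close>)

lemma bdlat_if_separated:
  fixes C :: "(dop, 'c) alg"
  assumes C: "algebra dar C"
    and sep: "\<And>x y. x \<in> carrier C \<Longrightarrow> y \<in> carrier C \<Longrightarrow> x \<noteq> y \<Longrightarrow>
      \<exists>D\<in>{L :: (dop, 'c) alg. bdlat L}. \<exists>h\<in>hom dar C D. h x \<noteq> h y"
  shows "bdlat C"
proof -
  define m where "m = (\<lambda>x y. opn C Meet [x, y])"
  define jn where "jn = (\<lambda>x y. opn C Join [x, y])"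
  define z where "z = opn C Zero []"
  define e where "e = opn C One []"
  have cl: "m x y \<in> carrier C" "jn x y \<in> carrier C" "z \<in> carrier C" "e \<in> carrier C"
    if "x \<in> carrier C" "y \<in> carrier C" for x y
    using C that by (auto simp: algebra_def m_def jn_def z_def e_def)
  have hm: "h (m x y) = opn D Meet [h x, h y]" "h (jn x y) = opn D Join [h x, h y]"
    "h z = opn D Zero []" "h e = opn D One []"
    if "h \<in> hom dar C D" "x \<in> carrier C" "y \<in> carrier C" for h x y and D :: "(dop, 'c) alg"
    using that by (auto simp: m_def jn_def z_def e_def homD(2)[OF that(1)])
  have eqI: "x = y"
    if "x \<in> carrier C" "y \<in> carrier C" "\<And>(D :: (dop, 'c) alg) h. bdlat D \<Longrightarrow> h \<in> hom dar C D \<Longrightarrow> h x = h y" for x y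
    using sep[OF that(1,2)] that(3) by blast
  have "m x y = m y x \<and> jn x y = jn y x \<and>
        m (m x y) w = m x (m y w) \<and> jn (jn x y) w = jn x (jn y w) \<and>
        m x (jn x y) = x \<and> jn x (m x y) = x \<and>
        m x (jn y w) = jn (m x y) (m x w) \<and> jn x z = x \<and> m x e = x"
    if *: "x \<in> carrier C" "y \<in> carrier C" "w \<in> carrier C" for x y w
  proof (intro conjI)
    have D: "opn D Meet [h x, h y] = opn D Meet [h y, h x] \<and> opn D Join [h x, h y] = opn D Join [h y, h x] \<and>
      opn D Meet [opn D Meet [h x, h y], h w] = opn D Meet [h x, opn D Meet [h y, h w]] \<and>
      opn D Join [opn D Join [h x, h y], h w] = opn D Join [h x, opn D Join [h y, h w]] \<and>
      opn D Meet [h x, opn D Join [h x, h y]] = h x \<and> opn D Join [h x, opn D Meet [h x, h y]] = h x \<and>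
      opn D Meet [h x, opn D Join [h y, h w]] = opn D Join [opn D Meet [h x, h y], opn D Meet [h x, h w]] \<and>
      opn D Join [h x, opn D Zero []] = h x \<and> opn D Meet [h x, opn D One []] = h x"
      if "bdlat D" "h \<in> hom dar C D" for h and D :: "(dop, 'c) alg"
      using that(1) homD(1)[OF that(2)] * unfolding bdlat_def Let_def by blast
    show "m x y = m y x" by (rule eqI) (simp_all add: * cl hm, blast dest: D)
    show "jn x y = jn y x" by (rule eqI) (simp_all add: * cl hm, blast dest: D)
    show "m (m x y) w = m x (m y w)" by (rule eqI) (simp_all add: * cl hm, blast dest: D)
    show "jn (jn x y) w = jn x (jn y w)" by (rule eqI) (simp_all add: * cl hm, blast dest: D)
    show "m x (jn x y) = x" by (rule eqI) (simp_all add: * cl hm, blast dest: D)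
    show "jn x (m x y) = x" by (rule eqI) (simp_all add: * cl hm, blast dest: D)
    show "m x (jn y w) = jn (m x y) (m x w)" by (rule eqI) (simp_all add: * cl hm, blast dest: D)
    show "jn x z = x"
      by (rule eqI) (simp_all add: * cl(3)[OF *(1,1)] cl hm hm(3)[OF _ *(1,1)], blast dest: D)
    show "m x e = x"
      by (rule eqI) (simp_all add: * cl(4)[OF *(1,1)] cl hm hm(4)[OF _ *(1,1)], blast dest: D)
  qed
  with C show ?thesis
    unfolding bdlat_def Let_def m_def jn_def z_def e_def by blast
qed

lemma coproduct_exists_bdlat:
  fixes K :: "('f, 'a) alg set"
  assumes "K \<noteq> {}" "\<And>B. B \<in> K \<Longrightarrow> bdlat (U \<tau> B)"
  shows "\<exists>P \<delta>. coprod_D \<tau> K P \<delta>"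
  unfolding coprod_D_def
proof (rule coproduct_exists[where j = "map_trm Inr (\<lambda>p. p)"])
  show "inj (map_trm Inr (\<lambda>p. p) :: (dop, ('f, 'a) alg \<times> 'a) trm \<Rightarrow> ('f, 'a) univ)"
    by (rule trm.inj_map) auto
  show "algebra dar (U \<tau> B)" if "B \<in> K" for B using assms(2)[OF that] by (simp add: bdlat_def)
  show "C \<in> {L. bdlat L}" if "algebra dar C" "\<And>x y. x \<in> carrier C \<Longrightarrow> y \<in> carrier C \<Longrightarrow> x \<noteq> y \<Longrightarrow>
      \<exists>D\<in>{L :: (dop, ('f, 'a) univ) alg. bdlat L}. \<exists>h\<in>hom dar C D. h x \<noteq> h y" for C :: "(dop, ('f, 'a) univ) alg"
    using bdlat_if_separated[OF that] by simp
qed (use assms(1) in \<open>auto simp: bdlat_def\<close>)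

end

theory Submission
  imports Defs
begin

text \<open>Everything is tied to (5). Let \<open>x = \<omega>\<^sub>1 \<circ> h\<^sub>1\<close> and \<open>y = \<omega>\<^sub>2 \<circ> h\<^sub>2\<close> be points of the dual of \<open>U A\<close>,
  where \<open>h\<^sub>i : A \<rightarrow> M\<^sub>i\<close>. Then \<open>x \<le> y\<close> on a subalgebra \<open>B\<close> of \<open>A\<close> iff the image of \<open>B\<close> in \<open>M\<^sub>1 \<times> M\<^sub>2\<close>
  lies below \<open>(\<omega>\<^sub>1, \<omega>\<^sub>2)\<close>, i.e. in \<open>(\<omega>\<^sub>1, \<omega>\<^sub>2)\<^sup>-\<^sup>1(\<le>)\<close>; and (5) says that any two such subalgebras of
  \<open>M\<^sub>1 \<times> M\<^sub>2\<close> lie in a third one.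

  (5) implies (3): an \<open>n\<close>-ary term \<open>t\<close> is determined by its truth values \<open>\<omega> (t a)\<close> at the finitely
  many points \<open>(\<omega>, a)\<close>, \<open>a \<in> M\<^sup>n\<close>. If \<open>t\<close> is true at \<open>(\<omega>\<^sub>1, a)\<close> and false at \<open>(\<omega>\<^sub>2, b)\<close>, then so is
  some \<open>u (x\<^sub>i)\<close> with \<open>u\<close> unary: otherwise all the subalgebras generated by a single \<open>(a\<^sub>i, b\<^sub>i)\<close> lie
  below \<open>(\<omega>\<^sub>1, \<omega>\<^sub>2)\<close>, hence so does a subalgebra containing all of them, and with it \<open>(t a, t b)\<close>.
  Therefore \<open>t\<close> is the join over all true points of the meet over all false points of these
  \<open>u (x\<^sub>i)\<close>. No prime ideal theorem is needed, as (Sep) supplies the separating points.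

  (3) implies (4) and (1): for a sublattice \<open>L\<close> of \<open>U A\<close>, the elements all of whose unary terms lie
  in \<open>L\<close> form the largest subalgebra inside \<open>L\<close>; for (1) take \<open>L\<close> to be the image of \<open>\<chi>\<close>. (1) implies
  (6), because the coproduct of lattices is generated by its cocone.

  (4), (6) and (2) imply (5): two subalgebras \<open>S\<^sub>1, S\<^sub>2\<close> of \<open>M\<^sub>1 \<times> M\<^sub>2\<close> below \<open>(\<omega>\<^sub>1, \<omega>\<^sub>2)\<close> are joined by
  applying (4) to the sublattice of pairs below \<open>(\<omega>\<^sub>1, \<omega>\<^sub>2)\<close>, or by mapping the coproduct of \<open>S\<^sub>1\<close>
  and \<open>S\<^sub>2\<close>, respectively that of one copy of the free algebra for each element of \<open>S\<^sub>1 \<union> S\<^sub>2\<close>, to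
  \<open>M\<^sub>1 \<times> M\<^sub>2\<close>.\<close>

section \<open>Terms, subalgebras, homomorphisms and products\<close>

lemma eval_cong: "(\<And>v. v \<in> vars t \<Longrightarrow> \<sigma> v = \<sigma>' v) \<Longrightarrow> eval A \<sigma> t = eval A \<sigma>' t"
proof (induction t)
  case (App f ts)
  then have "map (eval A \<sigma>) ts = map (eval A \<sigma>') ts" by fastforce
  then show ?case by (simp del: map_eq_conv)
qed simp

fun trm_subst :: "('v \<Rightarrow> ('f, 'w) trm) \<Rightarrow> ('f, 'v) trm \<Rightarrow> ('f, 'w) trm" where
  "trm_subst s (Var v) = s v"
| "trm_subst s (App f ts) = App f (map (trm_subst s) ts)"

lemma eval_trm_subst: "eval A \<sigma> (trm_subst s t) = eval A (\<lambda>v. eval A \<sigma> (s v)) t"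
proof (induction t)
  case (App f ts)
  then have "map (eval A \<sigma> \<circ> trm_subst s) ts = map (eval A (\<lambda>v. eval A \<sigma> (s v))) ts" by simp
  then show ?case by (simp del: map_eq_conv)
qed simp

lemma wf_trm_subst:
  "wf_trm ar t \<Longrightarrow> (\<And>v. v \<in> vars t \<Longrightarrow> wf_trm ar (s v)) \<Longrightarrow> wf_trm ar (trm_subst s t)"
  by (induction t) auto

lemma vars_trm_subst: "vars (trm_subst s t) = (\<Union>v\<in>vars t. vars (s v))"
  by (induction t) auto

lemma nary_Var: "nary ar n (Var i) \<longleftrightarrow> i < n"
  by (simp add: nary_def)

lemma nary_App:
  "nary ar n (App f ts) \<longleftrightarrow> length ts = ar f \<and> (\<forall>t\<in>set ts. nary ar n t)"
  by (auto simp: nary_def)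

lemma eval_closed_nary:
  "algebra ar A \<Longrightarrow> nary ar n t \<Longrightarrow> (\<And>i. i < n \<Longrightarrow> \<sigma> i \<in> carrier A) \<Longrightarrow> eval A \<sigma> t \<in> carrier A"
  by (rule eval_closed) (auto simp: nary_def)

lemma eval_hom_nary:
  assumes "algebra ar A" "h \<in> hom ar A B" "nary ar n t" "\<And>i. i < n \<Longrightarrow> \<sigma> i \<in> carrier A"
  shows "h (eval A \<sigma> t) = eval B (\<lambda>i. h (\<sigma> i)) t"
  using assms by (intro eval_hom[where ar = ar]) (auto simp: nary_def)

lemma eval_cong_nary:
  "nary ar n t \<Longrightarrow> (\<And>i. i < n \<Longrightarrow> \<sigma> i = \<sigma>' i) \<Longrightarrow> eval A \<sigma> t = eval A \<sigma>' t"
  by (rule eval_cong) (auto simp: nary_def)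

lemma algebra_sub_alg: "subuniverse ar A S \<Longrightarrow> algebra ar (sub_alg A S)"
  by (auto simp: subuniverse_def algebra_def sub_alg_def)

lemma carrier_sub_alg [simp]: "carrier (sub_alg A S) = S"
  and opn_sub_alg [simp]: "opn (sub_alg A S) = opn A"
  by (simp_all add: sub_alg_def)

lemma eval_sub_alg [simp]: "eval (sub_alg A S) \<sigma> t = eval A \<sigma> t"
proof (induction t)
  case (App f ts)
  then have "map (eval (sub_alg A S) \<sigma>) ts = map (eval A \<sigma>) ts" by simp
  then show ?case by (simp del: map_eq_conv)
qed simp

lemma subuniverse_carrier: "algebra ar A \<Longrightarrow> subuniverse ar A (carrier A)"
  by (simp add: algebra_def subuniverse_def)

lemma eval_subuniverse:
  "subuniverse ar A S \<Longrightarrow> wf_trm ar t \<Longrightarrow> (\<And>v. v \<in> vars t \<Longrightarrow> \<sigma> v \<in> S) \<Longrightarrow> eval A \<sigma> t \<in> S"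
  using eval_closed[OF algebra_sub_alg, of ar A S t \<sigma>] by simp

lemma eval_subuniverse_nary:
  "subuniverse ar A S \<Longrightarrow> nary ar n t \<Longrightarrow> (\<And>i. i < n \<Longrightarrow> \<sigma> i \<in> S) \<Longrightarrow> eval A \<sigma> t \<in> S"
  by (rule eval_subuniverse) (auto simp: nary_def)

text \<open>An operation applied to values of unary terms at \<open>a\<close> is again such a value.
  This presents the subalgebra generated by one element through unary terms, the link between those
  terms and subalgebras.\<close>

lemma subuniverse_generated:
  assumes A: "algebra ar A" and a: "a \<in> carrier A"
  shows "subuniverse ar A {eval A (\<lambda>_. a) t |t. nary ar 1 t}"
  unfolding subuniverse_def
proof (intro conjI allI impI)
  show "{eval A (\<lambda>_. a) t |t. nary ar 1 t} \<subseteq> carrier A"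
    using eval_closed_nary[OF A] a by auto
  have "nary ar 1 (Var 0)" by (simp add: nary_Var)
  then show "{eval A (\<lambda>_. a) t |t. nary ar 1 t} \<noteq> {}" by blast
  fix f xs
  assume *: "length xs = ar f \<and> set xs \<subseteq> {eval A (\<lambda>_. a) t |t. nary ar 1 t}"
  then have "\<forall>x\<in>set xs. \<exists>t. nary ar 1 t \<and> x = eval A (\<lambda>_. a) t" by blast
  then obtain T where T: "\<And>x. x \<in> set xs \<Longrightarrow> nary ar 1 (T x) \<and> x = eval A (\<lambda>_. a) (T x)" by metis
  have m: "map (eval A (\<lambda>_. a) \<circ> T) xs = xs"
    by (rule map_idI) (use T in simp)
  have "opn A f xs = eval A (\<lambda>_. a) (App f (map T xs))"
    by (simp add: m)
  moreover have "nary ar 1 (App f (map T xs))" using * T by (simp add: nary_App)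
  ultimately show "opn A f xs \<in> {eval A (\<lambda>_. a) t |t. nary ar 1 t}" by blast
qed

lemma hom_compose:
  assumes A: "algebra ar A" and h: "h \<in> hom ar A B" and k: "k \<in> hom ar B C"
  shows "compose (carrier A) k h \<in> hom ar A C"
  unfolding compose_def
proof (rule restrict_homI[OF A])
  show "k (h x) \<in> carrier C" if "x \<in> carrier A" for x
    using homD(1)[OF k homD(1)[OF h that]] .
  fix f xs assume *: "length xs = ar f" "set xs \<subseteq> carrier A"
  then have "set (map h xs) \<subseteq> carrier B" using homD(1)[OF h] by auto
  with * show "k (h (opn A f xs)) = opn C f (map (\<lambda>x. k (h x)) xs)"
    by (simp add: homD(2)[OF h] homD(2)[OF k] comp_def)
qed

lemma hom_id: "algebra ar A \<Longrightarrow> restrict (\<lambda>x. x) (carrier A) \<in> hom ar A A"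
  by (rule restrict_homI) simp_all

lemma hom_restrict_sub:
  assumes "subuniverse ar A S" "h \<in> hom ar A B"
  shows "restrict h S \<in> hom ar (sub_alg A S) B"
proof -
  have S: "S \<subseteq> carrier A" using assms(1) by (simp add: subuniverse_def)
  have "restrict h (carrier (sub_alg A S)) \<in> hom ar (sub_alg A S) B"
  proof (rule restrict_homI[OF algebra_sub_alg[OF assms(1)]])
    show "h x \<in> carrier B" if "x \<in> carrier (sub_alg A S)" for x
      using that S homD(1)[OF assms(2)] by auto
    show "h (opn (sub_alg A S) f xs) = opn B f (map h xs)"
      if "length xs = ar f" "set xs \<subseteq> carrier (sub_alg A S)" for f xs
      using homD(2)[OF assms(2), of xs f] that S by auto
  qed
  then show ?thesis by simp
qed

lemma subuniverse_hom_image: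
  assumes h: "h \<in> hom ar A B" and S: "subuniverse ar A S"
  shows "subuniverse ar B (h ` S)"
  unfolding subuniverse_def
proof (intro conjI allI impI)
  have SA: "S \<subseteq> carrier A" using S by (simp add: subuniverse_def)
  show "h ` S \<subseteq> carrier B" using homD(1)[OF h] SA by blast
  show "h ` S \<noteq> {}" using S by (simp add: subuniverse_def)
  fix f xs assume *: "length xs = ar f \<and> set xs \<subseteq> h ` S"
  then have "xs \<in> map h ` lists S" unfolding lists_image[symmetric] by auto
  then obtain ys where ys: "xs = map h ys" "set ys \<subseteq> S" by auto
  with * SA have "opn B f xs = h (opn A f ys)" by (subst homD(2)[OF h]) auto
  moreover have "opn A f ys \<in> S" using S ys * by (simp add: subuniverse_def)
  ultimately show "opn B f xs \<in> h ` S" by blast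
qed

lemma algebra_pair_alg:
  assumes "algebra ar A" "algebra ar B"
  shows "algebra ar (pair_alg A B)"
  unfolding algebra_def
proof (intro conjI allI impI)
  fix f xs assume *: "length xs = ar f \<and> set xs \<subseteq> carrier (pair_alg A B)"
  then have "set (map fst xs) \<subseteq> carrier A" "set (map snd xs) \<subseteq> carrier B"
    by (auto simp: pair_alg_def)
  with * assms show "opn (pair_alg A B) f xs \<in> carrier (pair_alg A B)"
    by (simp add: pair_alg_def algebra_def)
qed (use assms in \<open>simp add: pair_alg_def algebra_def\<close>)

lemma fst_hom: "algebra ar A \<Longrightarrow> algebra ar B \<Longrightarrow>
    restrict fst (carrier (pair_alg A B)) \<in> hom ar (pair_alg A B) A"
  by (rule restrict_homI[OF algebra_pair_alg]) (auto simp: pair_alg_def)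

lemma snd_hom: "algebra ar A \<Longrightarrow> algebra ar B \<Longrightarrow>
    restrict snd (carrier (pair_alg A B)) \<in> hom ar (pair_alg A B) B"
  by (rule restrict_homI[OF algebra_pair_alg]) (auto simp: pair_alg_def)

lemma pair_hom:
  assumes "algebra ar C" "h \<in> hom ar C A" "k \<in> hom ar C B"
  shows "(\<lambda>x\<in>carrier C. (h x, k x)) \<in> hom ar C (pair_alg A B)"
  by (rule restrict_homI[OF assms(1)])
    (auto simp: pair_alg_def homD[OF assms(2)] homD[OF assms(3)] comp_def)

lemma eval_pair_alg:
  "eval (pair_alg A B) \<sigma> t = (eval A (\<lambda>v. fst (\<sigma> v)) t, eval B (\<lambda>v. snd (\<sigma> v)) t)"
proof (induction t)
  case (App f ts)
  then have "map (fst \<circ> eval (pair_alg A B) \<sigma>) ts = map (eval A (\<lambda>v. fst (\<sigma> v))) ts"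
    "map (snd \<circ> eval (pair_alg A B) \<sigma>) ts = map (eval B (\<lambda>v. snd (\<sigma> v))) ts" by simp_all
  then show ?case by (simp add: pair_alg_def del: map_eq_conv)
qed simp

lemma algebra_prod_alg:
  assumes "\<And>i. i \<in> I \<Longrightarrow> algebra ar (N i)"
  shows "algebra ar (prod_alg I N)"
  unfolding algebra_def
proof (intro conjI allI impI)
  show "carrier (prod_alg I N) \<noteq> {}"
    using assms by (auto simp: prod_alg_def algebra_def PiE_eq_empty_iff)
  fix f xs assume *: "length xs = ar f \<and> set xs \<subseteq> carrier (prod_alg I N)"
  show "opn (prod_alg I N) f xs \<in> carrier (prod_alg I N)"
    unfolding prod_alg_def alg.simps
  proof (rule restrict_PiE_iff[THEN iffD2], rule ballI)
    fix i assume i: "i \<in> I"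
    have "set (map (\<lambda>x. x i) xs) \<subseteq> carrier (N i)"
      using * i by (auto simp: prod_alg_def)
    then show "opn (N i) f (map (\<lambda>x. x i) xs) \<in> carrier (N i)"
      using assms[OF i] * by (simp add: algebra_def)
  qed
qed

lemma proj_hom:
  assumes "\<And>i. i \<in> I \<Longrightarrow> algebra ar (N i)" "i \<in> I"
  shows "(\<lambda>x\<in>carrier (prod_alg I N). x i) \<in> hom ar (prod_alg I N) (N i)"
  by (rule restrict_homI[OF algebra_prod_alg]) (use assms in \<open>auto simp: prod_alg_def\<close>)

text \<open>Transport of structure along a map meant to be injective on the carrier, usually into
  another type. It moves algebras to the carrier type in which a condition or a universal property
  is stated.\<close>

definition copy_alg :: "('a \<Rightarrow> 'b) \<Rightarrow> ('f, 'a) alg \<Rightarrow> ('f, 'b) alg" where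
  "copy_alg j A = \<lparr>carrier = j ` carrier A,
                   opn = (\<lambda>f xs. j (opn A f (map (inv_into (carrier A) j) xs)))\<rparr>"

lemma carrier_copy_alg [simp]: "carrier (copy_alg j A) = j ` carrier A"
  by (simp add: copy_alg_def)

lemma
  assumes A: "algebra ar A" and j: "inj_on j (carrier A)"
  shows algebra_copy_alg: "algebra ar (copy_alg j A)"
    and copy_hom: "restrict j (carrier A) \<in> hom ar A (copy_alg j A)"
    and uncopy_hom: "restrict (inv_into (carrier A) j) (j ` carrier A) \<in> hom ar (copy_alg j A) A"
proof -
  have cl: "opn A f (map (inv_into (carrier A) j) xs) \<in> carrier A"
    if "length xs = ar f" "set xs \<subseteq> j ` carrier A" for f xs
  proof -
    have "set (map (inv_into (carrier A) j) xs) \<subseteq> carrier A"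
      using that(2) by (auto intro: inv_into_into)
    with A that(1) show ?thesis by (simp add: algebra_def)
  qed
  show B: "algebra ar (copy_alg j A)"
    using A cl by (auto simp: algebra_def copy_alg_def)
  show "restrict j (carrier A) \<in> hom ar A (copy_alg j A)"
  proof (rule restrict_homI[OF A])
    fix f xs assume *: "length xs = ar f" "set xs \<subseteq> carrier A"
    have "map (inv_into (carrier A) j \<circ> j) xs = xs"
      by (rule map_idI) (use * j in auto)
    then show "j (opn A f xs) = opn (copy_alg j A) f (map j xs)"
      by (simp add: copy_alg_def)
  qed simp
  have "restrict (inv_into (carrier A) j) (carrier (copy_alg j A)) \<in> hom ar (copy_alg j A) A"
  proof (rule restrict_homI[OF B])
    fix f xs assume *: "length xs = ar f" "set xs \<subseteq> carrier (copy_alg j A)"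
    then show "inv_into (carrier A) j (opn (copy_alg j A) f xs) =
        opn A f (map (inv_into (carrier A) j) xs)"
      using cl j by (simp add: copy_alg_def)
  qed (auto simp: inv_into_into)
  then show "restrict (inv_into (carrier A) j) (j ` carrier A) \<in> hom ar (copy_alg j A) A" by simp
qed

lemma iso_copy_alg:
  assumes "algebra ar A" "inj_on j (carrier A)"
  shows "iso ar A (copy_alg j A)"
  unfolding iso_def using copy_hom[OF assms] assms(2)
  by (intro bexI[of _ "restrict j (carrier A)"]) (auto simp: bij_betw_def inj_on_def)

section \<open>Membership in \<open>ISP\<close> across carrier types\<close>

lemma ISP_algebra: "A \<in> ISP ar \<MM> \<Longrightarrow> algebra ar A"
  by (simp add: ISP_def)

text \<open>A separating homomorphism into a member of \<open>ISP\<close> is composed with one into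
  a member of \<open>\<MM>\<close>. The types \<open>'c\<close> and \<open>'d\<close> are
  independent, so that membership passes between carrier types.\<close>

lemma ISP_if_separated_ISP:
  fixes A :: "('f, 'c) alg"
  assumes \<MM>: "\<And>M. M \<in> \<MM> \<Longrightarrow> algebra ar M" and A: "algebra ar A"
    and sep: "\<And>x y. x \<in> carrier A \<Longrightarrow> y \<in> carrier A \<Longrightarrow> x \<noteq> y \<Longrightarrow>
      \<exists>D\<in>ISP ar \<MM>. \<exists>h\<in>hom ar A (D :: ('f, 'd) alg). h x \<noteq> h y"
  shows "A \<in> ISP ar \<MM>"
proof -
  have "\<exists>M\<in>\<MM>. \<exists>h\<in>hom ar A M. h x \<noteq> h y"
    if xy: "x \<in> carrier A" "y \<in> carrier A" "x \<noteq> y" for x y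
  proof -
    obtain D :: "('f, 'd) alg" and h where D: "D \<in> ISP ar \<MM>" and h: "h \<in> hom ar A D" "h x \<noteq> h y"
      using sep[OF xy] by blast
    then obtain M k where M: "M \<in> \<MM>" and k: "k \<in> hom ar D M" "k (h x) \<noteq> k (h y)"
      using ISP_iff_separated[where A = D, OF \<MM>] homD(1)[OF h(1)] xy by blast
    then have "compose (carrier A) k h x \<noteq> compose (carrier A) k h y"
      using xy by (simp add: compose_def)
    then show ?thesis using M hom_compose[OF A h(1) k(1)] by blast
  qed
  with A show ?thesis using ISP_iff_separated[where A = A, OF \<MM>] by blast
qed

lemma ISP_if_embedded:
  fixes D :: "('f, 'd) alg"
  assumes "\<And>M. M \<in> \<MM> \<Longrightarrow> algebra ar M" "algebra ar A"
    and "h \<in> hom ar A D" "inj_on h (carrier A)" "D \<in> ISP ar \<MM>"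
  shows "A \<in> ISP ar \<MM>"
proof (rule ISP_if_separated_ISP[OF assms(1,2)])
  show "\<exists>D\<in>ISP ar \<MM>. \<exists>h\<in>hom ar A (D :: ('f, 'd) alg). h x \<noteq> h y"
    if "x \<in> carrier A" "y \<in> carrier A" "x \<noteq> y" for x y
    using that assms(4) by (intro bexI[OF _ assms(5)] bexI[OF _ assms(3)]) (auto simp: inj_on_def)
qed

lemma ISP_sub_alg:
  assumes "\<And>M. M \<in> \<MM> \<Longrightarrow> algebra ar M" "A \<in> ISP ar \<MM>" "subuniverse ar A S"
  shows "sub_alg A S \<in> ISP ar \<MM>"
proof (rule ISP_if_embedded[OF assms(1) algebra_sub_alg[OF assms(3)] _ _ assms(2)])
  show "restrict (restrict (\<lambda>x. x) (carrier A)) S \<in> hom ar (sub_alg A S) A"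
    using hom_restrict_sub[OF assms(3) hom_id[OF ISP_algebra[OF assms(2)]]] .
qed (use assms(3) in \<open>auto simp: inj_on_def subuniverse_def\<close>)

lemma ISP_copy_alg:
  assumes "\<And>M. M \<in> \<MM> \<Longrightarrow> algebra ar M" "A \<in> ISP ar \<MM>" "inj_on j (carrier A)"
  shows "copy_alg j A \<in> ISP ar \<MM>"
proof (rule ISP_if_embedded[OF assms(1) _ uncopy_hom[OF _ assms(3)]])
  have A: "algebra ar A" using assms(2) by (rule ISP_algebra)
  then show "algebra ar A" "algebra ar (copy_alg j A)" using assms(3) by (simp_all add: algebra_copy_alg)
qed (use assms in \<open>simp_all add: inj_on_inv_into\<close>)

lemma ISP_iso:
  assumes "\<And>M. M \<in> \<MM> \<Longrightarrow> algebra ar M" "algebra ar B" "A \<in> ISP ar \<MM>" "iso ar A B"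
  shows "B \<in> ISP ar \<MM>"
proof -
  obtain h where h: "h \<in> hom ar A B" "bij_betw h (carrier A) (carrier B)"
    using assms(4) by (auto simp: iso_def)
  let ?k = "restrict (inv_into (carrier A) h) (carrier B)"
  have A: "algebra ar A" using ISP_algebra[OF assms(3)] .
  have inv: "inv_into (carrier A) h y \<in> carrier A" "h (inv_into (carrier A) h y) = y"
    if "y \<in> carrier B" for y
    using that h(2) by (auto simp: bij_betw_def inv_into_into f_inv_into_f)
  have k: "?k \<in> hom ar B A"
  proof (rule restrict_homI[OF assms(2) inv(1)])
    fix f ys assume *: "length ys = ar f" "set ys \<subseteq> carrier B"
    let ?xs = "map (inv_into (carrier A) h) ys"
    have xs: "set ?xs \<subseteq> carrier A" using * inv(1) by auto
    have "map h ?xs = ys" unfolding map_map by (rule map_idI) (use * inv(2) in auto)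
    then have "opn B f ys = h (opn A f ?xs)" using homD(2)[OF h(1), of ?xs f] * xs by simp
    moreover have "opn A f ?xs \<in> carrier A" using A * xs by (simp add: algebra_def)
    ultimately show "inv_into (carrier A) h (opn B f ys) = opn A f ?xs"
      using h(2) by (simp add: bij_betw_def)
  qed
  have "inj_on ?k (carrier B)"
    using inj_on_inv_into[of "carrier B" h "carrier A"] h(2) by (simp add: bij_betw_def)
  then show ?thesis
    using ISP_if_embedded[OF assms(1,2) k _ assms(3)] by blast
qed

section \<open>Generation of coproducts\<close>

lemma
  fixes C :: "('f, 'c) alg"
  assumes "is_coproduct ar \<C> K B C \<epsilon>" "D \<in> \<C>" "\<And>i. i \<in> K \<Longrightarrow> \<phi> i \<in> hom ar (B i) D"
  shows coproduct_ex1: "\<exists>!h. h \<in> hom ar C D \<and> (\<forall>i\<in>K. \<forall>x\<in>carrier (B i). h (\<epsilon> i x) = \<phi> i x)"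
    and coproduct_induced: "\<exists>h\<in>hom ar C D. \<forall>i\<in>K. \<forall>x\<in>carrier (B i). h (\<epsilon> i x) = \<phi> i x"
    and coproduct_unique: "\<And>h k. h \<in> hom ar C D \<Longrightarrow> k \<in> hom ar C D \<Longrightarrow>
      (\<And>i x. i \<in> K \<Longrightarrow> x \<in> carrier (B i) \<Longrightarrow> h (\<epsilon> i x) = \<phi> i x) \<Longrightarrow>
      (\<And>i x. i \<in> K \<Longrightarrow> x \<in> carrier (B i) \<Longrightarrow> k (\<epsilon> i x) = \<phi> i x) \<Longrightarrow> h = k"
proof -
  show *: "\<exists>!h. h \<in> hom ar C D \<and> (\<forall>i\<in>K. \<forall>x\<in>carrier (B i). h (\<epsilon> i x) = \<phi> i x)"
    using assms(1)[unfolded is_coproduct_def, THEN conjunct2, THEN conjunct2, rule_format, OF assms(2,3)] .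
  then show "\<exists>h\<in>hom ar C D. \<forall>i\<in>K. \<forall>x\<in>carrier (B i). h (\<epsilon> i x) = \<phi> i x"
    unfolding Bex_def by (rule ex1_implies_ex)
  have ex1_unique: "x = y" if "\<exists>!x. P x" "P x" "P y" for P and x y :: "'c \<Rightarrow> 'c"
    using that by blast
  show "h = k"
    if "h \<in> hom ar C D" "k \<in> hom ar C D" "\<And>i x. i \<in> K \<Longrightarrow> x \<in> carrier (B i) \<Longrightarrow> h (\<epsilon> i x) = \<phi> i x"
      "\<And>i x. i \<in> K \<Longrightarrow> x \<in> carrier (B i) \<Longrightarrow> k (\<epsilon> i x) = \<phi> i x" for h k
    by (rule ex1_unique[OF *]) (simp_all add: that)
qed

text \<open>The cocone corestricted to \<open>S\<close> induces a map from \<open>C\<close> to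
  \<open>S\<close>. As an endomorphism of \<open>C\<close> it agrees with the identity on the
  cocone, hence everywhere, and its values lie in \<open>S\<close>.\<close>

lemma coproduct_generated:
  assumes cop: "is_coproduct ar \<C> K B C \<epsilon>" and C: "algebra ar C"
    and S: "subuniverse ar C S" "sub_alg C S \<in> \<C>"
    and \<epsilon>S: "\<And>i x. i \<in> K \<Longrightarrow> x \<in> carrier (B i) \<Longrightarrow> \<epsilon> i x \<in> S"
  shows "carrier C = S"
proof
  have SC: "S \<subseteq> carrier C" using S(1) by (simp add: subuniverse_def)
  then show "S \<subseteq> carrier C" .
  have \<epsilon>: "\<epsilon> i \<in> hom ar (B i) C" if "i \<in> K" for i
    using cop that by (simp add: is_coproduct_def)
  have \<epsilon>': "\<epsilon> i \<in> hom ar (B i) (sub_alg C S)" if i: "i \<in> K" for i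
    by (rule homI) (use \<epsilon>S[OF i] homD[OF \<epsilon>[OF i]] in auto)
  obtain h where h: "h \<in> hom ar C (sub_alg C S)" "\<forall>i\<in>K. \<forall>x\<in>carrier (B i). h (\<epsilon> i x) = \<epsilon> i x"
    using coproduct_induced[OF cop S(2) \<epsilon>'] by blast
  have hC: "h \<in> hom ar C C"
    by (rule homI) (use SC homD[OF h(1)] in auto)
  have id: "\<forall>i\<in>K. \<forall>x\<in>carrier (B i). restrict (\<lambda>x. x) (carrier C) (\<epsilon> i x) = \<epsilon> i x"
    using homD(1)[OF \<epsilon>] by simp
  have "C \<in> \<C>" using cop by (simp add: is_coproduct_def)
  then have "h = restrict (\<lambda>x. x) (carrier C)"
    by (rule coproduct_unique[OF cop _ \<epsilon> hC hom_id[OF C]]) (use h(2) id in auto)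
  then show "carrier C \<subseteq> S" using homD(1)[OF h(1)] by auto
qed

section \<open>Lattice reducts and lattice terms\<close>

lemma algebra_U:
  assumes "\<And>g. nary ar (dar g) (\<tau> g)" "algebra ar A"
  shows "algebra dar (U \<tau> A)"
  using assms(2) eval_closed_nary[OF assms(2) assms(1)]
  by (auto simp: algebra_def U_def subset_iff)

lemma carrier_U [simp]: "carrier (U \<tau> A) = carrier A"
  by (simp add: U_def)

lemma hom_U:
  assumes \<tau>: "\<And>g. nary ar (dar g) (\<tau> g)" and A: "algebra ar A" and h: "h \<in> hom ar A B"
  shows "h \<in> hom dar (U \<tau> A) (U \<tau> B)"
proof (rule homI)
  fix g xs assume *: "length xs = dar g" "set xs \<subseteq> carrier (U \<tau> A)"
  then have "h (eval A (\<lambda>i. xs ! i) (\<tau> g)) = eval B (\<lambda>i. h (xs ! i)) (\<tau> g)"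
    by (intro eval_hom_nary[OF A h \<tau>]) (simp add: subset_iff)
  also have "\<dots> = eval B (\<lambda>i. map h xs ! i) (\<tau> g)"
    by (rule eval_cong_nary[OF \<tau>]) (use * in simp)
  finally show "h (opn (U \<tau> A) g xs) = opn (U \<tau> B) g (map h xs)" by (simp add: U_def)
qed (use homD[OF h] in auto)

lemma dop_length_cases:
  assumes "length xs = dar g"
  obtains x y where "g = Meet" "xs = [x, y]" | x y where "g = Join" "xs = [x, y]"
    | "g = Zero" "xs = []" | "g = One" "xs = []"
  using assms by (cases g) (auto simp: numeral_2_eq_2 length_Suc_conv)

text \<open>The laws of bounded distributive lattices hold in \<open>two\<close>, and homomorphisms
  that jointly separate elements reflect them.\<close>

lemma bdlat_if_separated_two:
  assumes L: "algebra dar L"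
    and sep: "\<And>x y. x \<in> carrier L \<Longrightarrow> y \<in> carrier L \<Longrightarrow> x \<noteq> y \<Longrightarrow> \<exists>h\<in>H L. h x \<noteq> h y"
  shows "bdlat L"
proof -
  have cl: "opn L Meet [x, y] \<in> carrier L" "opn L Join [x, y] \<in> carrier L"
    "opn L Zero [] \<in> carrier L" "opn L One [] \<in> carrier L"
    if "x \<in> carrier L" "y \<in> carrier L" for x y
    using L that by (auto simp: algebra_def)
  have hm: "h (opn L Meet [x, y]) = (h x \<and> h y)" "h (opn L Join [x, y]) = (h x \<or> h y)"
    "h (opn L Zero []) = False" "h (opn L One []) = True"
    if "h \<in> H L" "x \<in> carrier L" "y \<in> carrier L" for h x y
    using that by (auto simp: H_def homD(2)[where ar = dar] two_def)
  have eqI: "x = y" if "x \<in> carrier L" "y \<in> carrier L" "\<And>h. h \<in> H L \<Longrightarrow> h x = h y" for x y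
    using sep that by blast
  show ?thesis
    unfolding bdlat_def Let_def
    by (intro conjI ballI L; rule eqI; (simp add: cl; fail)?; (simp add: cl hm; fail)?) (auto simp: cl hm)
qed

text \<open>All operations of \<open>two\<close> are monotone, so the inequality survives them;
  nonemptiness comes from \<open>Zero\<close>.\<close>

lemma subuniverse_le:
  assumes L: "algebra dar L" and y: "y \<in> H L" and z: "z \<in> H L"
  shows "subuniverse dar L {x \<in> carrier L. y x \<le> z x}"
  unfolding subuniverse_def
proof (intro conjI allI impI)
  have op: "opn L g xs \<in> {x \<in> carrier L. y x \<le> z x}"
    if *: "length xs = dar g" "set xs \<subseteq> {x \<in> carrier L. y x \<le> z x}" for g xs
  proof -
    have "opn L g xs \<in> carrier L" using L * by (auto simp: algebra_def)
    moreover have "h (opn L g xs) = opn two g (map h xs)" if "h \<in> H L" for h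
      using homD(2)[of h dar L two] that * by (auto simp: H_def)
    ultimately show ?thesis
      using *(2) y z by (cases rule: dop_length_cases[OF *(1)]) (auto simp: two_def)
  qed
  show "{x \<in> carrier L. y x \<le> z x} \<noteq> {}" using op[of "[]" Zero] by auto
  show "opn L g xs \<in> {x \<in> carrier L. y x \<le> z x}"
    if "length xs = dar g \<and> set xs \<subseteq> {x \<in> carrier L. y x \<le> z x}" for g xs
    using op that by blast
qed blast

definition big_meet :: "(dop, 'v) trm list \<Rightarrow> (dop, 'v) trm" where
  "big_meet ts = foldr (\<lambda>t u. App Meet [t, u]) ts (App One [])"

definition big_join :: "(dop, 'v) trm list \<Rightarrow> (dop, 'v) trm" where
  "big_join ts = foldr (\<lambda>t u. App Join [t, u]) ts (App Zero [])"

lemma nary_big_meet: "(\<And>t. t \<in> set ts \<Longrightarrow> nary dar m t) \<Longrightarrow> nary dar m (big_meet ts)"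
  unfolding big_meet_def by (induction ts) (auto simp: nary_App)

lemma nary_big_join: "(\<And>t. t \<in> set ts \<Longrightarrow> nary dar m t) \<Longrightarrow> nary dar m (big_join ts)"
  unfolding big_join_def by (induction ts) (auto simp: nary_App)

lemma eval_two_big_meet: "eval two \<sigma> (big_meet ts) \<longleftrightarrow> (\<forall>t\<in>set ts. eval two \<sigma> t)"
  unfolding big_meet_def by (induction ts) (auto simp: two_def)

lemma eval_two_big_join: "eval two \<sigma> (big_join ts) \<longleftrightarrow> (\<exists>t\<in>set ts. eval two \<sigma> t)"
  unfolding big_join_def by (induction ts) (auto simp: two_def)

section \<open>Subalgebras of a product below an order relation\<close>

text \<open>The candidates from which \<open>Rset\<close> selects the maximal ones. Bounding the
  size of \<open>Rset\<close> is handled as directedness of this set.\<close>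

definition le_sub ::
  "('f \<Rightarrow> nat) \<Rightarrow> ('f, 'a) alg \<times> ('a \<Rightarrow> bool) \<Rightarrow> ('f, 'b) alg \<times> ('b \<Rightarrow> bool) \<Rightarrow> ('a \<times> 'b) set set"
  where "le_sub ar p q =
    {S. subuniverse ar (pair_alg (fst p) (fst q)) S \<and> S \<subseteq> le_preimage p q}"

lemma Rset_iff:
  "S \<in> Rset ar p q \<longleftrightarrow> S \<in> le_sub ar p q \<and> (\<forall>T\<in>le_sub ar p q. S \<subseteq> T \<longrightarrow> T = S)"
  by (auto simp: Rset_def le_sub_def)

text \<open>Two maximal members have a common upper bound and both equal it. An infinite
  \<open>Rset\<close> has \<open>card\<close> 0 by convention; over finite carriers that case does
  not arise.\<close>

lemma card_Rset_le_1_if_directed: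
  assumes "\<And>S1 S2. S1 \<in> le_sub ar p q \<Longrightarrow> S2 \<in> le_sub ar p q \<Longrightarrow> \<exists>T\<in>le_sub ar p q. S1 \<union> S2 \<subseteq> T"
  shows "card (Rset ar p q) \<le> 1"
proof (cases "finite (Rset ar p q)")
  case True
  have "S1 = S2" if "S1 \<in> Rset ar p q" "S2 \<in> Rset ar p q" for S1 S2
  proof -
    have "S1 \<in> le_sub ar p q" "S2 \<in> le_sub ar p q" using that by (simp_all add: Rset_iff)
    then obtain T where T: "T \<in> le_sub ar p q" "S1 \<subseteq> T" "S2 \<subseteq> T" using assms by blast
    then have "T = S1" "T = S2" using that unfolding Rset_iff by blast+
    then show ?thesis by simp
  qed
  then show ?thesis using card_le_Suc0_iff_eq[OF True] by simp
qed simp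

text \<open>By finiteness every candidate lies below a maximal one. If there is just one maximal
  candidate, it is above all others; \<open>S0\<close> ensures that one exists.\<close>

lemma le_sub_top:
  assumes "card (Rset ar p q) \<le> 1" "finite (carrier (fst p))" "finite (carrier (fst q))"
    and "S0 \<in> le_sub ar p q"
  obtains T where "T \<in> le_sub ar p q" "\<And>S. S \<in> le_sub ar p q \<Longrightarrow> S \<subseteq> T"
proof -
  have "le_sub ar p q \<subseteq> Pow (carrier (fst p) \<times> carrier (fst q))"
    by (auto simp: le_sub_def le_preimage_def)
  then have fin: "finite (le_sub ar p q)"
    using assms(2,3) by (auto intro: finite_subset)
  have mx: "\<exists>T\<in>Rset ar p q. S \<subseteq> T" if S: "S \<in> le_sub ar p q" for S
  proof -
    obtain T where "T \<in> le_sub ar p q" "S \<subseteq> T" "\<forall>T'\<in>le_sub ar p q. T \<subseteq> T' \<longrightarrow> T = T'"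
      using finite_has_maximal2[OF fin S] by blast
    then show ?thesis by (intro bexI[of _ T]) (auto simp: Rset_iff)
  qed
  have "finite (Rset ar p q)" using fin by (rule finite_subset[rotated]) (auto simp: Rset_iff)
  then have uniq: "S1 = S2" if "S1 \<in> Rset ar p q" "S2 \<in> Rset ar p q" for S1 S2
    using assms(1) that card_le_Suc0_iff_eq by auto
  obtain T where T: "T \<in> Rset ar p q" using mx[OF assms(4)] by blast
  show ?thesis
  proof (rule that)
    show "T \<in> le_sub ar p q" using T by (simp add: Rset_iff)
    show "S \<subseteq> T" if "S \<in> le_sub ar p q" for S
      using mx[OF that] uniq[OF _ T] by blast
  qed
qed

text \<open>Provides room in \<open>'a\<close> for copies of finite algebras: products of two
  members of \<open>\<MM>\<close>, the free algebra, and disjoint copies of it.\<close>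

lemma ex_inj_on_infinite:
  assumes "finite A" "infinite (UNIV :: 'b set)"
  obtains f :: "'a \<Rightarrow> 'b" where "inj_on f A"
proof -
  obtain B :: "'b set" where "finite B" "card B = card A"
    using infinite_arbitrarily_large[OF assms(2)] by blast
  with assms(1) show ?thesis using that inj_on_iff_card_le[of A B] by auto
qed

section \<open>The free algebra on one generator\<close>

text \<open>Freeness may be tested on \<open>\<MM>\<close>: an equation between unary terms at
  \<open>g\<close> is carried by the maps in \<open>ex\<close> to every element of every member of
  \<open>\<MM>\<close>, and from there to \<open>D\<close> by separation. So sending the value of a
  term at \<open>g\<close> to its value at \<open>d\<close> is well defined.\<close>

lemma is_free1I:
  fixes F :: "('f, 'b) alg"
  assumes \<MM>: "\<And>M. M \<in> \<MM> \<Longrightarrow> algebra ar M"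
    and F: "F \<in> ISP ar \<MM>" and g: "g \<in> carrier F"
    and gen: "\<And>x. x \<in> carrier F \<Longrightarrow> \<exists>t. nary ar 1 t \<and> x = eval F (\<lambda>_. g) t"
    and ex: "\<And>M a. M \<in> \<MM> \<Longrightarrow> a \<in> carrier M \<Longrightarrow> \<exists>h\<in>hom ar F M. h g = a"
  shows "is_free1 ar (ISP ar \<MM>) F g"
  unfolding is_free1_def
proof (intro conjI ballI F g)
  fix D :: "('f, 'b) alg" and d assume D: "D \<in> ISP ar \<MM>" and d: "d \<in> carrier D"
  note algF = ISP_algebra[OF F] and algD = ISP_algebra[OF D]
  have wd: "eval D (\<lambda>_. d) t = eval D (\<lambda>_. d) t'"
    if t: "nary ar 1 t" "nary ar 1 t'" "eval F (\<lambda>_. g) t = eval F (\<lambda>_. g) t'" for t t'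
  proof (rule ccontr)
    assume "eval D (\<lambda>_. d) t \<noteq> eval D (\<lambda>_. d) t'"
    moreover have cl: "eval D (\<lambda>_. d) u \<in> carrier D" if "nary ar 1 u" for u
      using eval_closed_nary[OF algD that] d by simp
    ultimately obtain M k where M: "M \<in> \<MM>" and k: "k \<in> hom ar D M"
      "k (eval D (\<lambda>_. d) t) \<noteq> k (eval D (\<lambda>_. d) t')"
      using ISP_iff_separated[where A = D, OF \<MM>] D cl[OF t(1)] cl[OF t(2)] by blast
    obtain h where h: "h \<in> hom ar F M" "h g = k d" using ex[OF M homD(1)[OF k(1) d]] by blast
    have "k (eval D (\<lambda>_. d) u) = h (eval F (\<lambda>_. g) u)" if "nary ar 1 u" for u
      using eval_hom_nary[OF algD k(1) that, of "\<lambda>_. d"] eval_hom_nary[OF algF h(1) that, of "\<lambda>_. g"]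
        d g h(2) by simp
    with k(2) t show False by simp
  qed
  define T where "T = (\<lambda>x. SOME t. nary ar 1 t \<and> x = eval F (\<lambda>_. g) t)"
  have T: "nary ar 1 (T x)" "eval F (\<lambda>_. g) (T x) = x" if "x \<in> carrier F" for x
    using someI_ex[OF gen[OF that]] by (simp_all add: T_def)
  define h where "h = (\<lambda>x\<in>carrier F. eval D (\<lambda>_. d) (T x))"
  have h_eval: "h (eval F (\<lambda>_. g) t) = eval D (\<lambda>_. d) t" if t: "nary ar 1 t" for t
  proof -
    have x: "eval F (\<lambda>_. g) t \<in> carrier F" using eval_closed_nary[OF algF t] g by simp
    have "eval D (\<lambda>_. d) (T (eval F (\<lambda>_. g) t)) = eval D (\<lambda>_. d) t"
      using T[OF x] t by (intro wd)
    then show ?thesis using x by (simp add: h_def)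
  qed
  have hom: "h \<in> hom ar F D"
    unfolding h_def
  proof (rule restrict_homI[OF algF])
    show "eval D (\<lambda>_. d) (T x) \<in> carrier D" if "x \<in> carrier F" for x
      using eval_closed_nary[OF algD T(1)[OF that]] d by simp
    fix f xs assume *: "length xs = ar f" "set xs \<subseteq> carrier F"
    have "map (eval F (\<lambda>_. g) \<circ> T) xs = xs" by (rule map_idI) (use * T(2) in auto)
    then have "opn F f xs = eval F (\<lambda>_. g) (App f (map T xs))" by simp
    moreover have "nary ar 1 (App f (map T xs))" using * T(1) by (auto simp: nary_App)
    ultimately have "h (opn F f xs) = eval D (\<lambda>_. d) (App f (map T xs))"
      using h_eval[of "App f (map T xs)"] by simp
    moreover have "opn F f xs \<in> carrier F" using algF * by (simp add: algebra_def)
    ultimately show "eval D (\<lambda>_. d) (T (opn F f xs)) = opn D f (map (\<lambda>x. eval D (\<lambda>_. d) (T x)) xs)"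
      by (simp add: h_def comp_def)
  qed
  have hg: "h g = d" using h_eval[of "Var 0"] by (simp add: nary_Var)
  show "\<exists>!h. h \<in> hom ar F D \<and> h g = d"
  proof (rule ex1I[of _ h])
    show "h \<in> hom ar F D \<and> h g = d" using hom hg by simp
    fix k assume k: "k \<in> hom ar F D \<and> k g = d"
    show "k = h"
    proof
      fix x show "k x = h x"
      proof (cases "x \<in> carrier F")
        case True
        then have "k x = eval D (\<lambda>_. d) (T x)"
          using eval_hom_nary[OF algF conjunct1[OF k] T(1)[OF True], of "\<lambda>_. g"] T(2)[OF True] g k
          by simp
        then show ?thesis using True by (simp add: h_def)
      next
        case False
        then show ?thesis using homD(3)[OF conjunct1[OF k]] by (simp add: h_def)
      qed
    qed
  qed
qed

section \<open>Finitely generated quasivarieties based on distributive lattices\<close>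

locale finitely_generated_quasivariety =
  fixes ar :: "'f \<Rightarrow> nat"
    and \<tau> :: "dop \<Rightarrow> ('f, nat) trm"
    and \<MM> :: "('f, 'a) alg set"
    and \<Omega> :: "(('f, 'a) alg \<times> ('a \<Rightarrow> bool)) set"
  assumes infinite_UNIV: "infinite (UNIV :: 'a set)"
    and finite_MM: "finite \<MM>"
    and MM: "\<And>M. M \<in> \<MM> \<Longrightarrow> algebra ar M \<and> finite (carrier M)"
    and D_based: "D_based ar \<tau> (ISP ar \<MM> :: ('f, 'a) alg set)"
    and Omega: "\<Omega> \<subseteq> (SIGMA M:\<MM>. H (U \<tau> M))"
    and Sep: "Sep ar \<MM> \<Omega>"
begin

section \<open>Separation by members of \<open>\<Omega>\<close>\<close>

lemma algebra_MM: "M \<in> \<MM> \<Longrightarrow> algebra ar M"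
  using MM by blast

lemma nary_tau: "nary ar (dar g) (\<tau> g)"
  using D_based by (simp add: D_based_def)

lemma OmegaD: "p \<in> \<Omega> \<Longrightarrow> fst p \<in> \<MM>" "p \<in> \<Omega> \<Longrightarrow> snd p \<in> H (U \<tau> (fst p))"
  using Omega by auto

lemma MM_ISP: "M \<in> \<MM> \<Longrightarrow> M \<in> ISP ar \<MM>"
proof (rule ISP_iff_separated[where A = M, OF algebra_MM, THEN iffD2])
  assume M: "M \<in> \<MM>"
  show "algebra ar M \<and> (\<forall>x\<in>carrier M. \<forall>y\<in>carrier M. x \<noteq> y \<longrightarrow> (\<exists>M'\<in>\<MM>. \<exists>h\<in>hom ar M M'. h x \<noteq> h y))"
    by (intro conjI ballI impI algebra_MM[OF M] bexI[OF _ M] bexI[OF _ hom_id[OF algebra_MM[OF M]]]) simp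
qed

lemma ISP_separated:
  assumes "A \<in> ISP ar \<MM>" "x \<in> carrier A" "y \<in> carrier A" "x \<noteq> y"
  obtains M h where "M \<in> \<MM>" "h \<in> hom ar A M" "h x \<noteq> h y"
  using assms ISP_iff_separated[where A = A, OF algebra_MM] by blast

lemma ISP_eqI:
  assumes "A \<in> ISP ar \<MM>" "x \<in> carrier A" "y \<in> carrier A"
    and "\<And>M h. M \<in> \<MM> \<Longrightarrow> h \<in> hom ar A M \<Longrightarrow> h x = h y"
  shows "x = y"
  using ISP_separated[OF assms(1-3)] assms(4) by blast

lemma hom_H:
  assumes "algebra ar A" "h \<in> hom ar A B" "y \<in> H (U \<tau> B)"
  shows "compose (carrier A) y h \<in> H (U \<tau> A)"
  using hom_compose[OF algebra_U[OF nary_tau assms(1)] hom_U[OF nary_tau assms(1,2)]] assms(3)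
  unfolding H_def by simp

text \<open>A separating map into some \<open>M\<close> in \<open>\<MM>\<close> is followed by the
  map \<open>u\<close> out of \<open>M\<close> that (Sep) provides for the two images.\<close>

lemma ISP_Omega_separated:
  assumes A: "A \<in> ISP ar \<MM>" and xy: "x \<in> carrier A" "y \<in> carrier A" "x \<noteq> y"
  obtains p h where "p \<in> \<Omega>" "h \<in> hom ar A (fst p)" "snd p (h x) \<noteq> snd p (h y)"
proof -
  obtain M k where M: "M \<in> \<MM>" and k: "k \<in> hom ar A M" "k x \<noteq> k y"
    using ISP_separated[OF assms] .
  then obtain M' u \<omega> where u: "u \<in> hom ar M M'" "(M', \<omega>) \<in> \<Omega>" "\<omega> (u (k x)) \<noteq> \<omega> (u (k y))"
    using Sep homD(1)[OF k(1)] xy unfolding Sep_def by metis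
  show ?thesis
  proof (rule that[OF u(2)])
    show "compose (carrier A) u k \<in> hom ar A (fst (M', \<omega>))"
      using hom_compose[OF ISP_algebra[OF A] k(1) u(1)] by simp
  qed (use u(3) xy in \<open>simp add: compose_def\<close>)
qed

text \<open>\<open>D_based\<close> speaks of carriers in \<open>'a\<close>. Separation by
  \<open>\<Omega>\<close> extends it to all carrier types, in particular to that of the
  coproducts.\<close>

lemma bdlat_U: "A \<in> ISP ar \<MM> \<Longrightarrow> bdlat (U \<tau> A)"
proof (rule bdlat_if_separated_two)
  assume A: "A \<in> ISP ar \<MM>"
  show "algebra dar (U \<tau> A)" using algebra_U[OF nary_tau ISP_algebra[OF A]] .
  fix x y assume "x \<in> carrier (U \<tau> A)" "y \<in> carrier (U \<tau> A)" "x \<noteq> y"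
  then have xy: "x \<in> carrier A" "y \<in> carrier A" "x \<noteq> y" by simp_all
  obtain p h where "p \<in> \<Omega>" "h \<in> hom ar A (fst p)" "snd p (h x) \<noteq> snd p (h y)"
    using ISP_Omega_separated[OF A xy] .
  with xy show "\<exists>h\<in>H (U \<tau> A). h x \<noteq> h y"
    using hom_H[OF ISP_algebra[OF A] _ OmegaD(2)] by (intro bexI[of _ "compose (carrier A) (snd p) h"])
      (auto simp: compose_def)
qed

lemma ISP_pair_alg:
  assumes "M \<in> \<MM>" "N \<in> \<MM>"
  shows "pair_alg M N \<in> ISP ar \<MM>"
proof -
  have M: "algebra ar M" "algebra ar N" using assms by (simp_all add: algebra_MM)
  have "\<exists>M'\<in>\<MM>. \<exists>h\<in>hom ar (pair_alg M N) M'. h x \<noteq> h y"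
    if "x \<in> carrier (pair_alg M N)" "y \<in> carrier (pair_alg M N)" "x \<noteq> y" for x y
  proof (cases "fst x = fst y")
    case False
    with that show ?thesis
      by (intro bexI[OF _ assms(1)] bexI[OF _ fst_hom[OF M]]) simp
  next
    case True
    with that(3) have "snd x \<noteq> snd y" by (auto simp: prod_eq_iff)
    with that show ?thesis
      by (intro bexI[OF _ assms(2)] bexI[OF _ snd_hom[OF M]]) simp
  qed
  then show ?thesis
    using ISP_iff_separated[where A = "pair_alg M N", OF algebra_MM] algebra_pair_alg[OF M] by blast
qed

text \<open>The condition quantifies over carriers in \<open>'a\<close>, where the members of
  \<open>\<MM>\<close> live. Both sides of the equation commute with homomorphisms into these, which
  separate the elements of \<open>A\<close>, so the same terms work for carriers in
  \<open>'c\<close>.\<close>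

lemma unary_decomposition_ISP:
  assumes "unary_decomposition ar \<tau> \<MM>" "n \<ge> 1" "nary ar n t"
  obtains m ts ix s where "\<And>j. j < m \<Longrightarrow> nary ar 1 (ts j) \<and> ix j < n" "nary dar m s"
    "\<And>(A :: ('f, 'c) alg) a. A \<in> ISP ar \<MM> \<Longrightarrow> (\<And>i. i < n \<Longrightarrow> a i \<in> carrier A) \<Longrightarrow>
      eval A a t = eval (U \<tau> A) (\<lambda>j. eval A (\<lambda>_. a (ix j)) (ts j)) s"
proof -
  obtain m ts ix s where ts: "\<forall>j<m. nary ar 1 (ts j) \<and> ix j < n" and s: "nary dar m s"
    and eq: "\<forall>M\<in>ISP ar \<MM>. \<forall>a. (\<forall>i<n. a i \<in> carrier (M :: ('f, 'a) alg)) \<longrightarrow>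
      eval M a t = eval (U \<tau> M) (\<lambda>j. eval M (\<lambda>_. a (ix j)) (ts j)) s"
    using assms(1)[unfolded unary_decomposition_def, THEN spec, THEN mp, OF assms(2),
        THEN spec, THEN mp, OF assms(3)]
    by (elim exE conjE) (rule that)
  show ?thesis
  proof (rule that[OF _ s])
    show "nary ar 1 (ts j) \<and> ix j < n" if "j < m" for j using ts that by blast
    fix A :: "('f, 'c) alg" and a
    assume A: "A \<in> ISP ar \<MM>" and a: "\<And>i. i < n \<Longrightarrow> a i \<in> carrier A"
    let ?b = "\<lambda>j. eval A (\<lambda>_. a (ix j)) (ts j)"
    note alg = ISP_algebra[OF A]
    have b: "?b j \<in> carrier (U \<tau> A)" if "j < m" for j
      using eval_closed_nary[OF alg, of 1 "ts j"] ts a that by simp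
    have "h (eval A a t) = h (eval (U \<tau> A) ?b s)" if M: "M \<in> \<MM>" and h: "h \<in> hom ar A M" for M h
    proof -
      have "h (eval A a t) = eval M (\<lambda>i. h (a i)) t"
        using eval_hom_nary[OF alg h assms(3) a] .
      also have "\<dots> = eval (U \<tau> M) (\<lambda>j. eval M (\<lambda>_. h (a (ix j))) (ts j)) s"
        using eq[THEN bspec, OF MM_ISP[OF M], THEN spec, of "\<lambda>i. h (a i)"] homD(1)[OF h a] by simp
      also have "\<dots> = eval (U \<tau> M) (\<lambda>j. h (?b j)) s"
      proof (rule eval_cong_nary[OF s])
        fix j assume "j < m"
        then show "eval M (\<lambda>_. h (a (ix j))) (ts j) = h (?b j)"
          using eval_hom_nary[OF alg h, of 1 "ts j"] ts a by simp
      qed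
      also have "\<dots> = h (eval (U \<tau> A) ?b s)"
        using eval_hom_nary[OF algebra_U[OF nary_tau alg] hom_U[OF nary_tau alg h] s b] by simp
      finally show ?thesis .
    qed
    note sep = this
    have "eval A a t \<in> carrier A" using eval_closed_nary[OF alg assms(3) a] .
    moreover have "eval (U \<tau> A) ?b s \<in> carrier A"
      using eval_closed_nary[OF algebra_U[OF nary_tau alg] s b] by simp
    ultimately show "eval A a t = eval (U \<tau> A) ?b s"
      using sep by (rule ISP_eqI[OF A])
  qed
qed

text \<open>Under the decomposition property this is the largest subalgebra inside a sublattice \<open>L\<close>,
  as every \<open>n\<close>-ary term stays in \<open>L\<close> as soon as all unary terms do.\<close>

definition unary_core :: "('f, 'c) alg \<Rightarrow> 'c set \<Rightarrow> 'c set" where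
  "unary_core A L = {a \<in> carrier A. \<forall>u. nary ar 1 u \<longrightarrow> eval A (\<lambda>_. a) u \<in> L}"

lemma unary_core_subset: "unary_core A L \<subseteq> L"
  by (auto simp: unary_core_def nary_Var dest!: spec[where x = "Var 0"])

lemma subuniverse_unary_core:
  assumes dec: "unary_decomposition ar \<tau> \<MM>" and A: "A \<in> ISP ar \<MM>"
    and L: "subuniverse dar (U \<tau> A) L" and ne: "unary_core A L \<noteq> {}"
  shows "subuniverse ar A (unary_core A L)"
  unfolding subuniverse_def
proof (intro conjI allI impI)
  show "unary_core A L \<subseteq> carrier A" by (auto simp: unary_core_def)
  fix f xs assume *: "length xs = ar f \<and> set xs \<subseteq> unary_core A L"
  obtain x0 where x0: "x0 \<in> unary_core A L" using ne by blast
  \<comment> \<open>The extra last entry \<open>x0\<close> makes the arity \<open>Suc (ar f)\<close>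
    positive, as the decomposition demands, and so covers constants as well.\<close>
  define a where "a = (\<lambda>i. (xs @ [x0]) ! i)"
  have a: "a i \<in> unary_core A L" if "i < Suc (ar f)" for i
  proof -
    have "a i \<in> set (xs @ [x0])" unfolding a_def using that * by (intro nth_mem) simp
    then show ?thesis using * x0 by auto
  qed
  have map_a: "map a [0..<ar f] = xs"
    using * by (intro nth_equalityI) (auto simp: a_def nth_append)
  have xsA: "set xs \<subseteq> carrier A" using * by (auto simp: unary_core_def)
  show "opn A f xs \<in> unary_core A L"
    unfolding unary_core_def
  proof (intro CollectI conjI allI impI)
    show "opn A f xs \<in> carrier A" using ISP_algebra[OF A] * xsA by (simp add: algebra_def)
    fix u assume u: "nary ar 1 u"
    \<comment> \<open>The unary term \<open>u\<close> composed with \<open>f\<close>; only the first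
      \<open>ar f\<close> variables occur in it.\<close>
    define t where "t = trm_subst (\<lambda>_ :: nat. App f (map Var [0..<ar f])) u"
    have ev: "eval A a t = eval A (\<lambda>_. opn A f xs) u"
      by (simp add: t_def eval_trm_subst comp_def map_a)
    have t: "nary ar (Suc (ar f)) t"
      using u by (auto simp: t_def nary_def vars_trm_subst intro: wf_trm_subst)
    obtain m ts ix s where ts: "\<And>j. j < m \<Longrightarrow> nary ar 1 (ts j) \<and> ix j < Suc (ar f)"
      and s: "nary dar m s" and eq: "\<And>(A :: ('f, 'b) alg) a. A \<in> ISP ar \<MM> \<Longrightarrow>
        (\<And>i. i < Suc (ar f) \<Longrightarrow> a i \<in> carrier A) \<Longrightarrow>
        eval A a t = eval (U \<tau> A) (\<lambda>j. eval A (\<lambda>_. a (ix j)) (ts j)) s"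
      by (rule unary_decomposition_ISP[OF dec _ t, where ?'c = 'b]) auto
    have "eval (U \<tau> A) (\<lambda>j. eval A (\<lambda>_. a (ix j)) (ts j)) s \<in> L"
      by (rule eval_subuniverse_nary[OF L s]) (use a ts in \<open>auto simp: unary_core_def\<close>)
    moreover have "a i \<in> carrier A" if "i < Suc (ar f)" for i
      using a[OF that] by (simp add: unary_core_def)
    ultimately show "eval A (\<lambda>_. opn A f xs) u \<in> L" using eq[OF A] ev by simp
  qed
qed (use ne in simp)

lemma sublattices_have_top_if_unary_decomposition:
  assumes "unary_decomposition ar \<tau> \<MM>"
  shows "sublattices_have_top_subalgebra ar \<tau> \<MM>"
  unfolding sublattices_have_top_subalgebra_def
proof (intro ballI allI impI)
  fix A :: "('f, 'a) alg" and L
  assume A: "A \<in> ISP ar \<MM>" and L: "subuniverse dar (U \<tau> A) L"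
  have sub: "B \<subseteq> unary_core A L" if B: "subuniverse ar A B" "B \<subseteq> L" for B
  proof
    fix b assume b: "b \<in> B"
    then have "eval A (\<lambda>_. b) u \<in> L" if "nary ar 1 u" for u
      using eval_subuniverse_nary[OF B(1) that, of "\<lambda>_. b"] B(2) by blast
    with b B(1) show "b \<in> unary_core A L"
      by (auto simp: unary_core_def subuniverse_def)
  qed
  show "\<not> (\<exists>B. subuniverse ar A B \<and> B \<subseteq> L) \<or>
    (\<exists>T. subuniverse ar A T \<and> T \<subseteq> L \<and> (\<forall>B. subuniverse ar A B \<and> B \<subseteq> L \<longrightarrow> B \<subseteq> T))"
  proof (cases "\<exists>B. subuniverse ar A B \<and> B \<subseteq> L")
    case True
    then obtain B where B: "subuniverse ar A B" "B \<subseteq> L" by blast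
    then have "unary_core A L \<noteq> {}" using sub[OF B] by (auto simp: subuniverse_def)
    note subuniverse_unary_core[OF assms A L this]
    then show ?thesis
      using unary_core_subset sub by (intro disjI2 exI[of _ "unary_core A L"]) simp
  qed simp
qed

section \<open>Coproducts in the quasivariety\<close>

lemma coprod_A_hom:
  assumes "coprod_A ar \<MM> K C \<epsilon>" "B \<in> K"
  shows "\<epsilon> B \<in> hom ar B C" "C \<in> ISP ar \<MM>"
  using assms by (simp_all add: coprod_A_def is_coproduct_def)

lemma coprod_A_generated:
  assumes cop: "coprod_A ar \<MM> K C \<epsilon>" and S: "subuniverse ar C S"
    and \<epsilon>S: "\<And>B x. B \<in> K \<Longrightarrow> x \<in> carrier B \<Longrightarrow> \<epsilon> B x \<in> S"
  shows "carrier C = S"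
proof (rule coproduct_generated[OF cop[unfolded coprod_A_def] _ S _ \<epsilon>S])
  have "C \<in> ISP ar \<MM>" using cop by (simp add: coprod_A_def is_coproduct_def)
  then show "algebra ar C" "sub_alg C S \<in> ISP ar \<MM>"
    using ISP_algebra ISP_sub_alg[OF algebra_MM _ S] by blast+
qed

text \<open>The universal property of a coproduct is tested in \<^typ>\<open>('f, 'a) univ\<close> only, so the members
  of \<open>\<MM>\<close> are moved there.\<close>

lemma coprod_A_induced:
  assumes cop: "coprod_A ar \<MM> K C \<epsilon>" and M: "M \<in> \<MM>"
    and K: "\<And>B. B \<in> K \<Longrightarrow> algebra ar B" and \<phi>: "\<And>B. B \<in> K \<Longrightarrow> \<phi> B \<in> hom ar B M"
  obtains p where "p \<in> hom ar C M" "\<forall>B\<in>K. \<forall>x\<in>carrier B. p (\<epsilon> B x) = \<phi> B x"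
proof -
  define j :: "'a \<Rightarrow> ('f, 'a) univ" where "j = (\<lambda>a. Var (M, a))"
  have j: "inj_on j (carrier M)" by (simp add: j_def inj_on_def)
  have D: "copy_alg j M \<in> ISP ar \<MM>" using ISP_copy_alg[OF algebra_MM MM_ISP[OF M] j] .
  have alg: "algebra ar C" using cop by (auto simp: coprod_A_def is_coproduct_def ISP_algebra)
  let ?jr = "restrict j (carrier M)" and ?k = "restrict (inv_into (carrier M) j) (j ` carrier M)"
  have \<phi>': "compose (carrier B) ?jr (\<phi> B) \<in> hom ar B (copy_alg j M)" if "B \<in> K" for B
    using hom_compose[OF K[OF that] \<phi>[OF that] copy_hom[OF algebra_MM[OF M] j]] .
  obtain h where h: "h \<in> hom ar C (copy_alg j M)"
    "\<forall>B\<in>K. \<forall>x\<in>carrier B. h (\<epsilon> B x) = compose (carrier B) ?jr (\<phi> B) x"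
    using coproduct_induced[OF cop[unfolded coprod_A_def] D \<phi>'] by blast
  show ?thesis
  proof (rule that)
    show "compose (carrier C) ?k h \<in> hom ar C M"
      using hom_compose[OF alg h(1) uncopy_hom[OF algebra_MM[OF M] j]] .
    show "\<forall>B\<in>K. \<forall>x\<in>carrier B. compose (carrier C) ?k h (\<epsilon> B x) = \<phi> B x"
    proof (intro ballI)
      fix B x assume B: "B \<in> K" "x \<in> carrier B"
      then have "\<epsilon> B x \<in> carrier C" "\<phi> B x \<in> carrier M"
        using homD(1)[OF coprod_A_hom(1)[OF cop]] homD(1)[OF \<phi>] by blast+
      then show "compose (carrier C) ?k h (\<epsilon> B x) = \<phi> B x"
        using h(2) B j by (simp add: compose_def)
    qed
  qed
qed

text \<open>The substantial half of the order embedding property of \<open>iota\<close>; the reverse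
  implication holds since the cocone takes its values in \<open>C\<close>.\<close>

definition cocone_determines_order ::
  "('f, 'a) alg set \<Rightarrow> ('f, ('f, 'a) univ) alg \<Rightarrow> (('f, 'a) alg \<Rightarrow> 'a \<Rightarrow> ('f, 'a) univ) \<Rightarrow> bool" where
  "cocone_determines_order K C \<epsilon> \<longleftrightarrow> (\<forall>y\<in>H (U \<tau> C). \<forall>z\<in>H (U \<tau> C).
     (\<forall>B\<in>K. \<forall>x\<in>carrier B. y (\<epsilon> B x) \<le> z (\<epsilon> B x)) \<longrightarrow> (\<forall>c\<in>carrier C. y c \<le> z c))"

lemma iota_embedding_iff:
  "iota_embedding ar \<tau> \<MM> K \<longleftrightarrow>
     (\<forall>C \<epsilon>. coprod_A ar \<MM> K C \<epsilon> \<longrightarrow> cocone_determines_order K C \<epsilon>)"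
proof -
  have iota: "(\<forall>B\<in>K. \<forall>x\<in>carrier B. iota K \<epsilon> y B x \<le> iota K \<epsilon> z B x) \<longleftrightarrow>
      (\<forall>B\<in>K. \<forall>x\<in>carrier B. y (\<epsilon> B x) \<le> z (\<epsilon> B x))"
    for \<epsilon> :: "('f, 'a) alg \<Rightarrow> 'a \<Rightarrow> ('f, 'a) univ" and y z
    by (simp add: iota_def)
  have "((\<forall>B\<in>K. \<forall>x\<in>carrier B. y (\<epsilon> B x) \<le> z (\<epsilon> B x)) \<longleftrightarrow> (\<forall>c\<in>carrier C. y c \<le> z c)) \<longleftrightarrow>
      ((\<forall>B\<in>K. \<forall>x\<in>carrier B. y (\<epsilon> B x) \<le> z (\<epsilon> B x)) \<longrightarrow> (\<forall>c\<in>carrier C. y c \<le> z c))"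
    if "coprod_A ar \<MM> K C \<epsilon>" for C \<epsilon> y z
  proof -
    have "\<epsilon> B x \<in> carrier C" if "B \<in> K" "x \<in> carrier B" for B x
      using homD(1)[OF coprod_A_hom(1)[OF \<open>coprod_A ar \<MM> K C \<epsilon>\<close> that(1)] that(2)] .
    then show ?thesis by meson
  qed
  then show ?thesis
    unfolding iota_embedding_def cocone_determines_order_def iota
    by (intro iff_allI imp_cong refl ball_cong)
qed

section \<open>The comparison map between the two coproducts\<close>

lemma
  assumes A: "coprod_A ar \<MM> K C \<epsilon>" and D: "coprod_D \<tau> K P \<delta>" and K: "\<And>B. B \<in> K \<Longrightarrow> algebra ar B"
  shows chi_hom: "chi \<tau> K P \<delta> C \<epsilon> \<in> hom dar P (U \<tau> C)"
    and chi_cocone: "\<And>B x. B \<in> K \<Longrightarrow> x \<in> carrier B \<Longrightarrow> chi \<tau> K P \<delta> C \<epsilon> (\<delta> B x) = \<epsilon> B x"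
proof -
  have C: "C \<in> ISP ar \<MM>" using A by (simp add: coprod_A_def is_coproduct_def)
  \<comment> \<open>Unique existence, by the universal property of \<open>P\<close>, is what gives
    the definite description in \<open>chi\<close> its meaning.\<close>
  have "\<exists>!h. h \<in> hom dar P (U \<tau> C) \<and> (\<forall>B\<in>K. \<forall>x\<in>carrier (U \<tau> B). h (\<delta> B x) = \<epsilon> B x)"
    by (rule coproduct_ex1[OF D[unfolded coprod_D_def]])
      (use bdlat_U[OF C] hom_U[OF nary_tau K coprod_A_hom(1)[OF A]] in auto)
  then have "chi \<tau> K P \<delta> C \<epsilon> \<in> hom dar P (U \<tau> C) \<and>
      (\<forall>B\<in>K. \<forall>x\<in>carrier B. chi \<tau> K P \<delta> C \<epsilon> (\<delta> B x) = \<epsilon> B x)"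
    unfolding chi_def carrier_U by (rule theI')
  then show "chi \<tau> K P \<delta> C \<epsilon> \<in> hom dar P (U \<tau> C)"
    "\<And>B x. B \<in> K \<Longrightarrow> x \<in> carrier B \<Longrightarrow> chi \<tau> K P \<delta> C \<epsilon> (\<delta> B x) = \<epsilon> B x" by blast+
qed

lemma coprod_D_generated:
  assumes cop: "coprod_D \<tau> K P \<delta>" and S: "subuniverse dar P S"
    and \<delta>S: "\<And>B x. B \<in> K \<Longrightarrow> x \<in> carrier B \<Longrightarrow> \<delta> B x \<in> S"
  shows "carrier P = S"
proof -
  have P: "bdlat P" using cop by (simp add: coprod_D_def is_coproduct_def)
  then have "algebra dar P" by (simp add: bdlat_def)
  moreover have "bdlat (sub_alg P S)"
    unfolding bdlat_def Let_def carrier_sub_alg opn_sub_alg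
  proof (intro conjI algebra_sub_alg[OF S])
    have "S \<subseteq> carrier P" using S by (simp add: subuniverse_def)
    then show "\<forall>x\<in>S. \<forall>y\<in>S. \<forall>w\<in>S.
        opn P Meet [x, y] = opn P Meet [y, x] \<and> opn P Join [x, y] = opn P Join [y, x] \<and>
        opn P Meet [opn P Meet [x, y], w] = opn P Meet [x, opn P Meet [y, w]] \<and>
        opn P Join [opn P Join [x, y], w] = opn P Join [x, opn P Join [y, w]] \<and>
        opn P Meet [x, opn P Join [x, y]] = x \<and> opn P Join [x, opn P Meet [x, y]] = x \<and>
        opn P Meet [x, opn P Join [y, w]] = opn P Join [opn P Meet [x, y], opn P Meet [x, w]] \<and>
        opn P Join [x, opn P Zero []] = x \<and> opn P Meet [x, opn P One []] = x"
      using P[unfolded bdlat_def Let_def, THEN conjunct2] by blast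
  qed
  ultimately show ?thesis
    using coproduct_generated[OF cop[unfolded coprod_D_def] _ S] \<delta>S by simp
qed

text \<open>Pulled back along \<open>chi\<close>, the two points are comparable on a sublattice of
  \<open>P\<close> that contains the cocone, hence on all of \<open>P\<close>. Surjectivity of
  \<open>chi\<close> brings the inequality back to \<open>C\<close>.\<close>

lemma cocone_determines_order_if_chi_onto:
  assumes K: "K \<noteq> {}" "K \<subseteq> ISP ar \<MM>" and chi: "chi_onto ar \<tau> \<MM> K"
    and A: "coprod_A ar \<MM> K C \<epsilon>"
  shows "cocone_determines_order K C \<epsilon>"
  unfolding cocone_determines_order_def
proof (intro ballI impI)
  fix y z c
  assume y: "y \<in> H (U \<tau> C)" and z: "z \<in> H (U \<tau> C)"
    and le: "\<forall>B\<in>K. \<forall>x\<in>carrier B. y (\<epsilon> B x) \<le> z (\<epsilon> B x)" and c: "c \<in> carrier C"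
  have Kalg: "algebra ar B" if "B \<in> K" for B using that K(2) ISP_algebra by blast
  obtain P \<delta> where D: "coprod_D \<tau> K P \<delta>"
    using coproduct_exists_bdlat[OF K(1)] bdlat_U K(2) by blast
  have h: "chi \<tau> K P \<delta> C \<epsilon> \<in> hom dar P (U \<tau> C)"
    by (rule chi_hom[OF A D Kalg])
  have h\<delta>: "chi \<tau> K P \<delta> C \<epsilon> (\<delta> B x) = \<epsilon> B x" if "B \<in> K" "x \<in> carrier B" for B x
    by (rule chi_cocone[OF A D Kalg]) (use that in simp_all)
  let ?h = "chi \<tau> K P \<delta> C \<epsilon>"
  have P: "algebra dar P" using D by (simp add: coprod_D_def is_coproduct_def bdlat_def)
  have \<delta>P: "\<delta> B x \<in> carrier P" if "B \<in> K" "x \<in> carrier B" for B x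
    using D that homD(1)[of "\<delta> B" dar "U \<tau> B" P x] by (simp add: coprod_D_def is_coproduct_def)
  let ?y = "compose (carrier P) y ?h" and ?z = "compose (carrier P) z ?h"
  have yz: "?y \<in> H P" "?z \<in> H P"
    using hom_compose[OF P h] y z by (simp_all add: H_def)
  have eq: "carrier P = {w \<in> carrier P. ?y w \<le> ?z w}"
    by (rule coprod_D_generated[OF D subuniverse_le[OF P yz]])
      (use le \<delta>P h\<delta> in \<open>simp add: compose_def\<close>)
  obtain w where w: "w \<in> carrier P" "c = ?h w"
    using chi A D c unfolding chi_onto_def carrier_U by blast
  from w(1) have "?y w \<le> ?z w" by (subst (asm) eq) simp
  with w show "y c \<le> z c" by (simp add: compose_def)
qed

text \<open>Let \<open>L\<close> be the image of \<open>chi\<close>. A unary term at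
  \<open>\<epsilon> B x\<close> is \<open>\<epsilon> B\<close> of its value at \<open>x\<close>,
  hence in \<open>L\<close>. So the unary core of \<open>L\<close> is a subalgebra containing the
  cocone, which generates \<open>C\<close>.\<close>

lemma chi_onto_if_unary_decomposition:
  assumes dec: "unary_decomposition ar \<tau> \<MM>" and K: "K \<noteq> {}" "K \<subseteq> ISP ar \<MM>"
  shows "chi_onto ar \<tau> \<MM> K"
  unfolding chi_onto_def
proof (intro allI impI, elim conjE)
  fix C \<epsilon> P \<delta> assume A: "coprod_A ar \<MM> K C \<epsilon>" and D: "coprod_D \<tau> K P \<delta>"
  have Kalg: "algebra ar B" if "B \<in> K" for B using that K(2) ISP_algebra by blast
  have h: "chi \<tau> K P \<delta> C \<epsilon> \<in> hom dar P (U \<tau> C)"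
    by (rule chi_hom[OF A D Kalg])
  have h\<delta>: "chi \<tau> K P \<delta> C \<epsilon> (\<delta> B x) = \<epsilon> B x" if "B \<in> K" "x \<in> carrier B" for B x
    by (rule chi_cocone[OF A D Kalg]) (use that in simp_all)
  let ?L = "chi \<tau> K P \<delta> C \<epsilon> ` carrier P"
  have P: "algebra dar P" using D by (simp add: coprod_D_def is_coproduct_def bdlat_def)
  have L: "subuniverse dar (U \<tau> C) ?L"
    using subuniverse_hom_image[OF h subuniverse_carrier[OF P]] .
  have C: "C \<in> ISP ar \<MM>" using A by (simp add: coprod_A_def is_coproduct_def)
  have core: "\<epsilon> B x \<in> unary_core C ?L" if B: "B \<in> K" and x: "x \<in> carrier B" for B x
    unfolding unary_core_def
  proof (intro CollectI conjI allI impI)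
    show "\<epsilon> B x \<in> carrier C" using homD(1)[OF coprod_A_hom(1)[OF A B] x] .
    fix u assume u: "nary ar 1 u"
    have ux: "eval B (\<lambda>_. x) u \<in> carrier B" using eval_closed_nary[OF Kalg[OF B] u] x by simp
    then have "\<delta> B (eval B (\<lambda>_. x) u) \<in> carrier P"
      using D B homD(1)[of "\<delta> B" dar "U \<tau> B" P] by (simp add: coprod_D_def is_coproduct_def)
    moreover have "eval C (\<lambda>_. \<epsilon> B x) u = \<epsilon> B (eval B (\<lambda>_. x) u)"
      using eval_hom_nary[OF Kalg[OF B] coprod_A_hom(1)[OF A B] u, of "\<lambda>_. x"] x by simp
    ultimately show "eval C (\<lambda>_. \<epsilon> B x) u \<in> ?L" using h\<delta>[OF B ux] by (metis imageI)
  qed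
  obtain B where B: "B \<in> K" using K(1) by blast
  then have "unary_core C ?L \<noteq> {}" using core[OF B] Kalg[OF B] by (auto simp: algebra_def)
  then have "carrier C = unary_core C ?L"
    using coprod_A_generated[OF A subuniverse_unary_core[OF dec C L]] core by blast
  then show "?L = carrier (U \<tau> C)"
    using unary_core_subset[of C ?L] L by (auto simp: subuniverse_def)
qed

lemma preserves_coproducts_if_unary_decomposition:
  "unary_decomposition ar \<tau> \<MM> \<Longrightarrow> preserves_coproducts ar \<tau> \<MM>"
  unfolding preserves_coproducts_def using chi_onto_if_unary_decomposition by blast

lemma iotas_order_embeddings_if_preserves_coproducts:
  assumes "preserves_coproducts ar \<tau> \<MM>"
  shows "iotas_order_embeddings ar \<tau> \<MM>"
  unfolding iotas_order_embeddings_def iota_embedding_iff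
proof (intro allI impI, elim conjE)
  fix K C \<epsilon> assume "K \<noteq> {}" "K \<subseteq> ISP ar \<MM>" "coprod_A ar \<MM> K C \<epsilon>"
  moreover from this have "chi_onto ar \<tau> \<MM> K"
    using assms unfolding preserves_coproducts_def by simp
  ultimately show "cocone_determines_order K C \<epsilon>"
    by (intro cocone_determines_order_if_chi_onto)
qed

section \<open>Maximal subalgebras\<close>

lemma algebra_Omega: "p \<in> \<Omega> \<Longrightarrow> algebra ar (fst p)"
  by (rule algebra_MM[OF OmegaD(1)])

lemma finite_Omega_carrier: "p \<in> \<Omega> \<Longrightarrow> finite (carrier (fst p))"
  using OmegaD(1) MM by blast

lemma image_le_sub:
  assumes p: "p \<in> \<Omega>" and q: "q \<in> \<Omega>" and A: "algebra ar A"
    and h: "h \<in> hom ar A (fst p)" and k: "k \<in> hom ar A (fst q)"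
    and S: "subuniverse ar A S" and le: "\<And>x. x \<in> S \<Longrightarrow> snd p (h x) \<le> snd q (k x)"
  shows "(\<lambda>x. (h x, k x)) ` S \<in> le_sub ar p q"
proof -
  have SA: "S \<subseteq> carrier A" using S by (simp add: subuniverse_def)
  then have "(\<lambda>x\<in>carrier A. (h x, k x)) ` S = (\<lambda>x. (h x, k x)) ` S" by (intro image_cong) auto
  then have "subuniverse ar (pair_alg (fst p) (fst q)) ((\<lambda>x. (h x, k x)) ` S)"
    using subuniverse_hom_image[OF pair_hom[OF A h k] S] by simp
  moreover have "(\<lambda>x. (h x, k x)) ` S \<subseteq> le_preimage p q"
    using SA le homD(1)[OF h] homD(1)[OF k] by (auto simp: le_preimage_def)
  ultimately show ?thesis by (simp add: le_sub_def)
qed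

text \<open>The conditions concern carriers in \<open>'a\<close>, whereas the product is carried by
  pairs. Here \<open>A\<close> is a copy of the product, \<open>c\<close> the copying map, and
  \<open>h\<close>, \<open>k\<close> are the projections read off the copy.\<close>

lemma product_copy:
  assumes p: "p \<in> \<Omega>" and q: "q \<in> \<Omega>"
  obtains A :: "('f, 'a) alg" and c h k where "A \<in> ISP ar \<MM>"
    "c \<in> hom ar (pair_alg (fst p) (fst q)) A" "h \<in> hom ar A (fst p)" "k \<in> hom ar A (fst q)"
    "\<forall>x\<in>carrier (pair_alg (fst p) (fst q)). h (c x) = fst x \<and> k (c x) = snd x"
proof -
  let ?P = "pair_alg (fst p) (fst q)"
  have ISP: "?P \<in> ISP ar \<MM>" using ISP_pair_alg[OF OmegaD(1)[OF p] OmegaD(1)[OF q]] .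
  note P = ISP_algebra[OF ISP] and alg = algebra_Omega[OF p] algebra_Omega[OF q]
  have "finite (carrier ?P)"
    using finite_Omega_carrier[OF p] finite_Omega_carrier[OF q] by (simp add: pair_alg_def)
  then obtain j :: "'a \<times> 'a \<Rightarrow> 'a" where j: "inj_on j (carrier ?P)"
    using ex_inj_on_infinite[OF _ infinite_UNIV] by blast
  let ?A = "copy_alg j ?P" and ?i = "restrict (inv_into (carrier ?P) j) (j ` carrier ?P)"
  have A: "algebra ar ?A" using algebra_copy_alg[OF P j] .
  show ?thesis
  proof (rule that[OF ISP_copy_alg[OF algebra_MM ISP j] copy_hom[OF P j]])
    show "compose (carrier ?A) (restrict fst (carrier ?P)) ?i \<in> hom ar ?A (fst p)"
      using hom_compose[OF A uncopy_hom[OF P j] fst_hom[OF alg]] .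
    show "compose (carrier ?A) (restrict snd (carrier ?P)) ?i \<in> hom ar ?A (fst q)"
      using hom_compose[OF A uncopy_hom[OF P j] snd_hom[OF alg]] .
  qed (use j in \<open>simp_all add: compose_def\<close>)
qed

lemma card_Rset_le_1_if_top_subalgebra:
  assumes top: "sublattices_have_top_subalgebra ar \<tau> \<MM>" and p: "p \<in> \<Omega>" and q: "q \<in> \<Omega>"
  shows "card (Rset ar p q) \<le> 1"
proof (rule card_Rset_le_1_if_directed)
  let ?P = "pair_alg (fst p) (fst q)"
  fix S1 S2 assume S: "S1 \<in> le_sub ar p q" "S2 \<in> le_sub ar p q"
  obtain A :: "('f, 'a) alg" and c h k where A: "A \<in> ISP ar \<MM>"
    and c: "c \<in> hom ar ?P A" and h: "h \<in> hom ar A (fst p)" and k: "k \<in> hom ar A (fst q)"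
    and hk: "\<forall>x\<in>carrier ?P. h (c x) = fst x \<and> k (c x) = snd x"
    using product_copy[OF p q] .
  note algA = ISP_algebra[OF A]
  \<comment> \<open>The copy in \<open>A\<close> of the set of pairs in
    \<open>le_preimage p q\<close>.\<close>
  define L where "L = {x \<in> carrier A. snd p (h x) \<le> snd q (k x)}"
  have "L = {x \<in> carrier (U \<tau> A). compose (carrier A) (snd p) h x \<le> compose (carrier A) (snd q) k x}"
    by (auto simp: L_def compose_def)
  then have L: "subuniverse dar (U \<tau> A) L"
    using subuniverse_le[OF algebra_U[OF nary_tau algA] hom_H[OF algA h OmegaD(2)[OF p]]
        hom_H[OF algA k OmegaD(2)[OF q]]] by simp
  have cS: "subuniverse ar A (c ` S)" "c ` S \<subseteq> L" "S \<subseteq> carrier ?P" if "S \<in> le_sub ar p q" for S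
  proof -
    have *: "subuniverse ar ?P S" "S \<subseteq> le_preimage p q" using that by (auto simp: le_sub_def)
    then show S: "S \<subseteq> carrier ?P" by (simp add: subuniverse_def)
    show "subuniverse ar A (c ` S)" using subuniverse_hom_image[OF c *(1)] .
    show "c ` S \<subseteq> L" using S * hk homD(1)[OF c] by (fastforce simp: L_def le_preimage_def)
  qed
  obtain T where T: "subuniverse ar A T" "T \<subseteq> L"
    and max: "\<forall>B. subuniverse ar A B \<and> B \<subseteq> L \<longrightarrow> B \<subseteq> T"
    using top[unfolded sublattices_have_top_subalgebra_def, THEN bspec, OF A, THEN spec, THEN mp, OF L]
      cS[OF S(1)] by blast
  \<comment> \<open>The map given by \<open>h\<close> and \<open>k\<close> undoes \<open>c\<close>,
    so it takes the top subalgebra \<open>T\<close> back to the product.\<close>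
  have "S \<subseteq> (\<lambda>x. (h x, k x)) ` T" if "S \<in> le_sub ar p q" for S
  proof
    fix s assume s: "s \<in> S"
    then have "c s \<in> T" using max cS[OF that] by blast
    moreover have "s = (h (c s), k (c s))" using hk cS(3)[OF that] s by (auto simp: prod_eq_iff)
    ultimately show "s \<in> (\<lambda>x. (h x, k x)) ` T" by blast
  qed
  moreover have "(\<lambda>x. (h x, k x)) ` T \<in> le_sub ar p q"
    using image_le_sub[OF p q algA h k T(1)] T(2) by (auto simp: L_def)
  ultimately show "\<exists>T\<in>le_sub ar p q. S1 \<union> S2 \<subseteq> T" using S by blast
qed

text \<open>Both families factor through the coproduct. The induced points
  \<open>snd p \<circ> h\<close> and \<open>snd q \<circ> k\<close> are comparable on the cocone,
  hence on \<open>C\<close>, and the image of \<open>C\<close> under \<open>h\<close> and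
  \<open>k\<close> is the required \<open>T\<close>.\<close>

lemma le_sub_of_cocone:
  assumes p: "p \<in> \<Omega>" and q: "q \<in> \<Omega>" and cop: "coprod_A ar \<MM> K C \<epsilon>"
    and ord: "cocone_determines_order K C \<epsilon>"
    and K: "\<And>B. B \<in> K \<Longrightarrow> algebra ar B"
    and \<phi>: "\<And>B. B \<in> K \<Longrightarrow> \<phi> B \<in> hom ar B (fst p)" and \<psi>: "\<And>B. B \<in> K \<Longrightarrow> \<psi> B \<in> hom ar B (fst q)"
    and le: "\<And>B x. B \<in> K \<Longrightarrow> x \<in> carrier B \<Longrightarrow> snd p (\<phi> B x) \<le> snd q (\<psi> B x)"
  obtains T where "T \<in> le_sub ar p q"
    "\<And>B x. B \<in> K \<Longrightarrow> x \<in> carrier B \<Longrightarrow> (\<phi> B x, \<psi> B x) \<in> T"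
proof -
  obtain h where h: "h \<in> hom ar C (fst p)" "\<forall>B\<in>K. \<forall>x\<in>carrier B. h (\<epsilon> B x) = \<phi> B x"
    using coprod_A_induced[OF cop OmegaD(1)[OF p] K \<phi>] .
  obtain k where k: "k \<in> hom ar C (fst q)" "\<forall>B\<in>K. \<forall>x\<in>carrier B. k (\<epsilon> B x) = \<psi> B x"
    using coprod_A_induced[OF cop OmegaD(1)[OF q] K \<psi>] .
  have C: "algebra ar C" using cop by (auto simp: coprod_A_def is_coproduct_def ISP_algebra)
  have \<epsilon>C: "\<epsilon> B x \<in> carrier C" if "B \<in> K" "x \<in> carrier B" for B x
    using homD(1)[OF coprod_A_hom(1)[OF cop that(1)] that(2)] .
  let ?y = "compose (carrier C) (snd p) h" and ?z = "compose (carrier C) (snd q) k"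
  have "?y \<in> H (U \<tau> C)" "?z \<in> H (U \<tau> C)"
    using hom_H[OF C h(1) OmegaD(2)[OF p]] hom_H[OF C k(1) OmegaD(2)[OF q]] by blast+
  moreover have "\<forall>B\<in>K. \<forall>x\<in>carrier B. ?y (\<epsilon> B x) \<le> ?z (\<epsilon> B x)"
    using le h(2) k(2) \<epsilon>C by (simp add: compose_def)
  ultimately have "\<forall>c\<in>carrier C. ?y c \<le> ?z c"
    using ord[unfolded cocone_determines_order_def] by blast
  then have yz: "snd p (h c) \<le> snd q (k c)" if "c \<in> carrier C" for c
    using that by (simp add: compose_def)
  show ?thesis
  proof (rule that)
    show "(\<lambda>x. (h x, k x)) ` carrier C \<in> le_sub ar p q"
      using image_le_sub[OF p q C h(1) k(1) subuniverse_carrier[OF C] yz] .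
    fix B x assume "B \<in> K" "x \<in> carrier B"
    then show "(\<phi> B x, \<psi> B x) \<in> (\<lambda>x. (h x, k x)) ` carrier C"
      using h(2) k(2) \<epsilon>C by (intro image_eqI[of _ _ "\<epsilon> B x"]) auto
  qed
qed

lemma card_Rset_le_1_if_iotas_order_embeddings:
  assumes iota: "iotas_order_embeddings ar \<tau> \<MM>" and p: "p \<in> \<Omega>" and q: "q \<in> \<Omega>"
  shows "card (Rset ar p q) \<le> 1"
proof (rule card_Rset_le_1_if_directed)
  let ?P = "pair_alg (fst p) (fst q)"
  fix S1 S2 assume S: "S1 \<in> le_sub ar p q" "S2 \<in> le_sub ar p q"
  obtain A :: "('f, 'a) alg" and c h k where A: "A \<in> ISP ar \<MM>"
    and c: "c \<in> hom ar ?P A" and h: "h \<in> hom ar A (fst p)" and k: "k \<in> hom ar A (fst q)"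
    and hk: "\<forall>x\<in>carrier ?P. h (c x) = fst x \<and> k (c x) = snd x"
    using product_copy[OF p q] .
  \<comment> \<open>If \<open>S1 = S2\<close> the two algebras coincide. This is harmless, since the
    maps used below are restrictions of \<open>h\<close> and \<open>k\<close> and depend on the
    algebra alone.\<close>
  define K where "K = (\<lambda>S. sub_alg A (c ` S)) ` {S1, S2}"
  have SP: "subuniverse ar ?P S" "S \<subseteq> le_preimage p q" "S \<subseteq> carrier ?P" if "S \<in> {S1, S2}" for S
    using that S by (auto simp: le_sub_def subuniverse_def)
  have sub: "subuniverse ar A (c ` S)" if "S \<in> {S1, S2}" for S
    using subuniverse_hom_image[OF c SP(1)[OF that]] .
  have K: "K \<noteq> {}" "K \<subseteq> ISP ar \<MM>"
    using ISP_sub_alg[OF algebra_MM A sub] by (auto simp: K_def)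
  obtain C \<epsilon> where cop: "coprod_A ar \<MM> K C \<epsilon>"
    using coproduct_exists_ISP[OF algebra_MM K] by blast
  have ord: "cocone_determines_order K C \<epsilon>"
    using iota K cop unfolding iotas_order_embeddings_def iota_embedding_iff by simp
  obtain T where T: "T \<in> le_sub ar p q"
    and KT: "\<And>B x. B \<in> K \<Longrightarrow> x \<in> carrier B \<Longrightarrow> (restrict h (carrier B) x, restrict k (carrier B) x) \<in> T"
  proof (rule le_sub_of_cocone[OF p q cop ord])
    show "algebra ar B" if "B \<in> K" for B using that K(2) ISP_algebra by blast
    fix B assume "B \<in> K"
    then obtain S where B: "S \<in> {S1, S2}" "B = sub_alg A (c ` S)" by (auto simp: K_def)
    show "restrict h (carrier B) \<in> hom ar B (fst p)" "restrict k (carrier B) \<in> hom ar B (fst q)"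
      unfolding B(2) carrier_sub_alg
      using hom_restrict_sub[OF sub[OF B(1)] h] hom_restrict_sub[OF sub[OF B(1)] k] by blast+
    fix x assume x: "x \<in> carrier B"
    then obtain s where s: "s \<in> S" "x = c s" using B(2) by auto
    then have "s \<in> le_preimage p q" "s \<in> carrier ?P" using SP[OF B(1)] by blast+
    with x s show "snd p (restrict h (carrier B) x) \<le> snd q (restrict k (carrier B) x)"
      using hk by (auto simp: le_preimage_def)
  qed blast
  have "s \<in> T" if "S \<in> {S1, S2}" "s \<in> S" for S s
  proof -
    have "sub_alg A (c ` S) \<in> K" using that(1) by (auto simp: K_def)
    from KT[OF this, of "c s"] that(2) have "(h (c s), k (c s)) \<in> T" by simp
    moreover have "h (c s) = fst s" "k (c s) = snd s" using hk SP(3)[OF that(1)] that(2) by blast+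
    ultimately show ?thesis by simp
  qed
  then have "S1 \<union> S2 \<subseteq> T" by blast
  with T show "\<exists>T\<in>le_sub ar p q. S1 \<union> S2 \<subseteq> T" by blast
qed

section \<open>The free algebra and its disjoint copies\<close>

lemma ex_free1:
  obtains F :: "('f, 'a) alg" and g where "is_free1 ar (ISP ar \<MM>) F g" "finite (carrier F)"
    "\<forall>x\<in>carrier F. \<exists>t. nary ar 1 t \<and> x = eval F (\<lambda>_. g) t"
proof -
  \<comment> \<open>The free algebra is found inside the finite product over all pairs
    \<open>(M, a)\<close> with \<open>a\<close> in \<open>M\<close>, generated by the tuple
    \<open>g0\<close> whose coordinate at \<open>(M, a)\<close> is \<open>a\<close>.\<close>
  define P where "P = (SIGMA M:\<MM>. carrier M)"
  have P: "algebra ar (fst i)" if "i \<in> P" for i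
    using that algebra_MM by (auto simp: P_def)
  define G where "G = prod_alg P fst"
  define g0 where "g0 = (\<lambda>i\<in>P. snd i)"
  define S where "S = {eval G (\<lambda>_. g0) t |t. nary ar 1 t}"
  have cG: "carrier G = (\<Pi>\<^sub>E i\<in>P. carrier (fst i))" by (simp add: G_def prod_alg_def)
  have G: "algebra ar G" using algebra_prod_alg[of P ar fst] P by (simp add: G_def)
  have proj: "(\<lambda>x\<in>carrier G. x i) \<in> hom ar G (fst i)" if "i \<in> P" for i
    using proj_hom[of P ar fst, OF P that] by (simp add: G_def)
  have "\<exists>M\<in>\<MM>. \<exists>h\<in>hom ar G M. h x \<noteq> h y"
    if xy: "x \<in> carrier G" "y \<in> carrier G" "x \<noteq> y" for x y
  proof -
    obtain i where i: "i \<in> P" "x i \<noteq> y i" using xy PiE_ext unfolding cG by metis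
    have "fst i \<in> \<MM>" using i(1) by (auto simp: P_def)
    then show ?thesis by (rule bexI[rotated]) (rule bexI[OF _ proj[OF i(1)]], use xy i in simp)
  qed
  then have G_ISP: "G \<in> ISP ar \<MM>"
    using ISP_iff_separated[where A = G, OF algebra_MM] G by blast
  have g0: "g0 \<in> carrier G" by (auto simp: cG g0_def P_def)
  have S: "subuniverse ar G S" using subuniverse_generated[OF G g0] by (simp add: S_def)
  have SG: "S \<subseteq> carrier G" using S by (simp add: subuniverse_def)
  have "finite P" using finite_MM MM by (auto simp: P_def)
  then have "finite (carrier G)" unfolding cG using MM by (intro finite_PiE) (auto simp: P_def)
  then have finS: "finite S" using SG finite_subset by blast
  then obtain j :: "(('f, 'a) alg \<times> 'a \<Rightarrow> 'a) \<Rightarrow> 'a" where j: "inj_on j S"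
    using ex_inj_on_infinite[OF _ infinite_UNIV] by blast
  have g0S: "g0 \<in> S"
    unfolding S_def by (intro CollectI exI[of _ "Var 0"]) (simp add: nary_Var)
  let ?S = "sub_alg G S"
  have jS: "inj_on j (carrier ?S)" using j by simp
  have S_ISP: "?S \<in> ISP ar \<MM>" using ISP_sub_alg[OF algebra_MM G_ISP S] .
  note algS = ISP_algebra[OF S_ISP]
  define F where "F = copy_alg j ?S"
  have F_ISP: "F \<in> ISP ar \<MM>" unfolding F_def using ISP_copy_alg[OF algebra_MM S_ISP jS] .
  note algF = ISP_algebra[OF F_ISP]
  have cF: "carrier F = j ` S" by (simp add: F_def)
  have gen: "\<exists>t. nary ar 1 t \<and> x = eval F (\<lambda>_. j g0) t" if x: "x \<in> carrier F" for x
  proof -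
    obtain y where y: "y \<in> S" "x = j y" using x unfolding cF by blast
    then obtain t where t: "nary ar 1 t" "y = eval G (\<lambda>_. g0) t" unfolding S_def by blast
    have "restrict j S (eval G (\<lambda>_. g0) t) = eval F (\<lambda>_. restrict j S g0) t"
      using eval_hom_nary[OF algS copy_hom[OF algS jS] t(1), of "\<lambda>_. g0"] g0S by (simp add: F_def)
    with t y g0S show ?thesis by auto
  qed
  have "is_free1 ar (ISP ar \<MM>) F (j g0)"
  proof (rule is_free1I[OF algebra_MM F_ISP _ gen])
    show "j g0 \<in> carrier F" using g0S by (simp add: cF)
    fix M a assume "M \<in> \<MM>" "a \<in> carrier M"
    then have i: "(M, a) \<in> P" by (simp add: P_def)
    \<comment> \<open>Undo the copying and project to the coordinate \<open>(M, a)\<close>, where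
      \<open>g0\<close> takes the value \<open>a\<close>.\<close>
    let ?h = "compose (carrier F) (restrict (\<lambda>x\<in>carrier G. x (M, a)) S)
      (restrict (inv_into (carrier ?S) j) (j ` carrier ?S))"
    have "?h \<in> hom ar F M"
      using hom_compose[OF algF uncopy_hom[OF algS jS, folded F_def] hom_restrict_sub[OF S proj[OF i]]]
      by simp
    moreover have "?h (j g0) = a"
      using g0S g0 i j by (simp add: compose_def cF g0_def)
    ultimately show "\<exists>h\<in>hom ar F M. h (j g0) = a" by blast
  qed
  moreover have "finite (carrier F)" using finS by (simp add: cF)
  ultimately show ?thesis using that gen by blast
qed

lemma card_Rset_le_1_if_preserves_free_coproducts:
  assumes pres: "preserves_free_coproducts ar \<tau> \<MM>" and p: "p \<in> \<Omega>" and q: "q \<in> \<Omega>"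
  shows "card (Rset ar p q) \<le> 1"
proof (rule card_Rset_le_1_if_directed)
  let ?P = "pair_alg (fst p) (fst q)"
  fix S1 S2 assume S: "S1 \<in> le_sub ar p q" "S2 \<in> le_sub ar p q"
  define X where "X = S1 \<union> S2"
  have SP: "subuniverse ar ?P S" "S \<subseteq> le_preimage p q" if "S \<in> {S1, S2}" for S
    using that S by (auto simp: le_sub_def)
  have XP: "X \<subseteq> carrier (fst p) \<times> carrier (fst q)"
    using SP(2) by (auto simp: X_def le_preimage_def)
  have finX: "finite X"
    using finite_Omega_carrier[OF p] finite_Omega_carrier[OF q] XP by (auto intro: finite_subset)
  have neX: "X \<noteq> {}" using SP(1)[of S1] by (auto simp: X_def subuniverse_def)
  obtain F :: "('f, 'a) alg" and g where free: "is_free1 ar (ISP ar \<MM>) F g" and finF: "finite (carrier F)"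
    and gen: "\<forall>x\<in>carrier F. \<exists>t. nary ar 1 t \<and> x = eval F (\<lambda>_. g) t"
    using ex_free1 .
  have F: "F \<in> ISP ar \<MM>" "g \<in> carrier F" using free by (simp_all add: is_free1_def)
  note algF = ISP_algebra[OF F(1)]
  have "finite (X \<times> carrier F)" using finX finF by simp
  \<comment> \<open>Injectivity on the whole product makes the images of \<open>carrier F\<close>
    for different \<open>b\<close> disjoint.\<close>
  then obtain e :: "('a \<times> 'a) \<times> 'a \<Rightarrow> 'a" where e: "inj_on e (X \<times> carrier F)"
    using ex_inj_on_infinite[OF _ infinite_UNIV] by blast
  define E where "E = (\<lambda>b x. e (b, x))"
  have inj_E: "inj_on (E b) (carrier F)" if "b \<in> X" for b
    using e that by (auto simp: E_def inj_on_def)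
  have E_eq: "b = b'" if "E b x = E b' x'" "b \<in> X" "b' \<in> X" "x \<in> carrier F" "x' \<in> carrier F" for b b' x x'
    using e that by (auto simp: E_def inj_on_def)
  define Fb where "Fb = (\<lambda>b. copy_alg (E b) F)"
  have cFb: "carrier (Fb b) = E b ` carrier F" for b by (simp add: Fb_def)
  have inj_Fb: "inj_on Fb X"
  proof (rule inj_onI)
    fix b b' assume b: "b \<in> X" "b' \<in> X" "Fb b = Fb b'"
    then have "E b ` carrier F = E b' ` carrier F" using cFb by metis
    then obtain x where "x \<in> carrier F" "E b g = E b' x" using F(2) by blast
    then show "b = b'" using E_eq b F(2) by blast
  qed
  define K where "K = Fb ` X"
  have K_ISP: "K \<subseteq> ISP ar \<MM>"
    using ISP_copy_alg[OF algebra_MM F(1) inj_E] by (auto simp: K_def Fb_def)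
  have neK: "K \<noteq> {}" using neX by (simp add: K_def)
  have Kalg: "algebra ar B" if "B \<in> K" for B using that K_ISP ISP_algebra by blast
  have isoK: "iso ar F B" if "B \<in> K" for B
    using that iso_copy_alg[OF algF inj_E] by (auto simp: K_def Fb_def)
  have disj: "carrier B \<inter> carrier B' = {}" if "B \<in> K" "B' \<in> K" "B \<noteq> B'" for B B'
  proof -
    obtain b b' where b: "b \<in> X" "B = Fb b" "b' \<in> X" "B' = Fb b'" using \<open>B \<in> K\<close> \<open>B' \<in> K\<close> by (auto simp: K_def)
    with that(3) have "b \<noteq> b'" by metis
    show ?thesis
    proof (rule equals0I)
      fix y assume "y \<in> carrier B \<inter> carrier B'"
      then have "y \<in> E b ` carrier F" "y \<in> E b' ` carrier F" using b cFb by simp_all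
      then obtain x x' where "x \<in> carrier F" "x' \<in> carrier F" "E b x = E b' x'" by blast
      with E_eq[of b x b' x'] b \<open>b \<noteq> b'\<close> show False by blast
    qed
  qed
  have "chi_onto ar \<tau> \<MM> K"
    using pres[unfolded preserves_free_coproducts_def, THEN spec, THEN spec, THEN spec, THEN mp, of F g K]
      free neK finX Kalg isoK disj by (simp add: K_def)
  obtain C \<epsilon> where cop: "coprod_A ar \<MM> K C \<epsilon>"
    using coproduct_exists_ISP[OF algebra_MM neK K_ISP] by blast
  have ord: "cocone_determines_order K C \<epsilon>"
    using cocone_determines_order_if_chi_onto[OF neK K_ISP \<open>chi_onto ar \<tau> \<MM> K\<close> cop] .
  have ext: "\<exists>h. h \<in> hom ar F D \<and> h g = d" if "D \<in> \<MM>" "d \<in> carrier D" for D d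
    using free MM_ISP[OF that(1)] that(2) unfolding is_free1_def by (meson ex1_implies_ex)
  have "\<exists>h k. h \<in> hom ar F (fst p) \<and> h g = fst b \<and> k \<in> hom ar F (fst q) \<and> k g = snd b" if "b \<in> X" for b
    using ext[OF OmegaD(1)[OF p], of "fst b"] ext[OF OmegaD(1)[OF q], of "snd b"] that XP by auto
  then obtain u v where u: "\<And>b. b \<in> X \<Longrightarrow> u b \<in> hom ar F (fst p) \<and> u b g = fst b"
    and v: "\<And>b. b \<in> X \<Longrightarrow> v b \<in> hom ar F (fst q) \<and> v b g = snd b"
    by metis
  \<comment> \<open>Every \<open>x\<close> in \<open>F\<close> is a unary term at \<open>g\<close>,
    so the pair is that term at \<open>b\<close>, and this stays in whichever of \<open>S1\<close>,
    \<open>S2\<close> contains \<open>b\<close>.\<close>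
  have uv: "(u b x, v b x) \<in> le_preimage p q" if b: "b \<in> X" and x: "x \<in> carrier F" for b x
  proof -
    obtain t where t: "nary ar 1 t" "x = eval F (\<lambda>_. g) t" using gen x by blast
    have "u b x = eval (fst p) (\<lambda>_. fst b) t" "v b x = eval (fst q) (\<lambda>_. snd b) t"
      using eval_hom_nary[OF algF conjunct1[OF u[OF b]] t(1), of "\<lambda>_. g"] u[OF b]
        eval_hom_nary[OF algF conjunct1[OF v[OF b]] t(1), of "\<lambda>_. g"] v[OF b] F(2) t(2) by simp_all
    then have eq: "(u b x, v b x) = eval ?P (\<lambda>_. b) t" by (simp add: eval_pair_alg)
    obtain S where S: "S \<in> {S1, S2}" "b \<in> S" using b by (auto simp: X_def)
    then have "eval ?P (\<lambda>_. b) t \<in> S" using eval_subuniverse_nary[OF SP(1)[OF S(1)] t(1), of "\<lambda>_. b"] by simp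
    then show ?thesis using SP(2)[OF S(1)] eq by auto
  qed
  \<comment> \<open>The cocone is indexed by algebras, so \<open>b\<close> has to be recovered from
    its copy \<open>Fb b\<close>; injectivity of \<open>Fb\<close> permits this. After undoing the
    copying, \<open>w b\<close> is applied.\<close>
  define un where "un = (\<lambda>w B. compose (carrier B) (w (inv_into X Fb B))
    (restrict (inv_into (carrier F) (E (inv_into X Fb B))) (E (inv_into X Fb B) ` carrier F)) :: 'a \<Rightarrow> 'a)"
  have un: "un w (Fb b) (E b x) = w b x" if "b \<in> X" "x \<in> carrier F" for w b x
    using that inj_E inj_Fb by (simp add: un_def compose_def cFb)
  have un_hom: "un w (Fb b) \<in> hom ar (Fb b) D" if "b \<in> X" "w b \<in> hom ar F D" for w b D
  proof -
    have "inv_into X Fb (Fb b) = b" using inj_Fb that(1) by simp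
    moreover have copy_eq: "copy_alg (E b) F = Fb b" by (simp add: Fb_def)
    ultimately show ?thesis
      using hom_compose[OF algebra_copy_alg uncopy_hom, OF algF inj_E[OF that(1)] algF inj_E[OF that(1)]
          that(2)] by (simp add: un_def cFb copy_eq)
  qed
  obtain T where T: "T \<in> le_sub ar p q" "\<And>B x. B \<in> K \<Longrightarrow> x \<in> carrier B \<Longrightarrow> (un u B x, un v B x) \<in> T"
  proof (rule le_sub_of_cocone[OF p q cop ord Kalg, of "un u" "un v"])
    fix B assume "B \<in> K"
    then obtain b where b: "b \<in> X" "B = Fb b" by (auto simp: K_def)
    show "un u B \<in> hom ar B (fst p)" "un v B \<in> hom ar B (fst q)"
      using un_hom b u v by auto
    fix x assume "x \<in> carrier B"
    then obtain x' where "x' \<in> carrier F" "x = E b x'" using b by (auto simp: cFb)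
    then show "snd p (un u B x) \<le> snd q (un v B x)"
      using b uv[of b x'] by (simp add: un le_preimage_def)
  qed blast+
  have "X \<subseteq> T"
  proof
    fix b assume b: "b \<in> X"
    then have "(un u (Fb b) (E b g), un v (Fb b) (E b g)) \<in> T"
      using F(2) by (intro T(2)) (auto simp: K_def cFb)
    then show "b \<in> T" using b u v F(2) by (simp add: un)
  qed
  then show "\<exists>T\<in>le_sub ar p q. S1 \<union> S2 \<subseteq> T" using T(1) by (auto simp: X_def)
qed

section \<open>From unique maximal subalgebras to unary decompositions\<close>

lemma ex_separating_unary:
  assumes card: "card (Rset ar p q) \<le> 1" and p: "p \<in> \<Omega>" and q: "q \<in> \<Omega>"
    and t: "nary ar n t" "n \<ge> 1"
    and a: "\<And>i. i < n \<Longrightarrow> a i \<in> carrier (fst p)" and b: "\<And>i. i < n \<Longrightarrow> b i \<in> carrier (fst q)"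
    and neg: "\<not> snd p (eval (fst p) a t) \<le> snd q (eval (fst q) b t)"
  shows "\<exists>u i. nary ar 1 u \<and> i < n \<and>
    snd p (eval (fst p) (\<lambda>_. a i) u) \<and> \<not> snd q (eval (fst q) (\<lambda>_. b i) u)"
proof (rule ccontr)
  let ?P = "pair_alg (fst p) (fst q)"
  assume "\<not> (\<exists>u i. nary ar 1 u \<and> i < n \<and>
    snd p (eval (fst p) (\<lambda>_. a i) u) \<and> \<not> snd q (eval (fst q) (\<lambda>_. b i) u))"
  then have le: "snd p (eval (fst p) (\<lambda>_. a i) u) \<le> snd q (eval (fst q) (\<lambda>_. b i) u)"
    if "nary ar 1 u" "i < n" for u i
    using that by auto
  define S where "S = (\<lambda>i. {eval ?P (\<lambda>_. (a i, b i)) u |u. nary ar 1 u})"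
  note alg = algebra_Omega[OF p] algebra_Omega[OF q]
  have S: "S i \<in> le_sub ar p q" if i: "i < n" for i
  proof -
    have "subuniverse ar ?P (S i)"
      unfolding S_def using a[OF i] b[OF i]
      by (intro subuniverse_generated algebra_pair_alg alg) (simp add: pair_alg_def)
    moreover have "S i \<subseteq> le_preimage p q"
      using le[OF _ i] a[OF i] b[OF i] eval_closed_nary[OF alg(1)] eval_closed_nary[OF alg(2)]
      by (auto simp: S_def le_preimage_def eval_pair_alg)
    ultimately show ?thesis by (simp add: le_sub_def)
  qed
  \<comment> \<open>One top member contains all \<open>S i\<close> at once. Since
    \<open>n \<ge> 1\<close>, \<open>S 0\<close> witnesses that there are candidates at all.\<close>
  obtain T where T: "T \<in> le_sub ar p q" "\<And>S. S \<in> le_sub ar p q \<Longrightarrow> S \<subseteq> T"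
    using le_sub_top[OF card finite_Omega_carrier[OF p] finite_Omega_carrier[OF q] S[of 0]] t(2)
    by auto
  have "(a i, b i) \<in> T" if i: "i < n" for i
  proof -
    have "(a i, b i) \<in> S i"
      unfolding S_def by (intro CollectI exI[of _ "Var 0"]) (simp add: nary_Var)
    then show ?thesis using T(2)[OF S[OF i]] by blast
  qed
  then have "eval ?P (\<lambda>i. (a i, b i)) t \<in> T"
    using T(1) by (intro eval_subuniverse_nary[OF _ t(1)]) (auto simp: le_sub_def)
  then have "eval ?P (\<lambda>i. (a i, b i)) t \<in> le_preimage p q"
    using T(1) by (auto simp: le_sub_def)
  with neg show False by (simp add: eval_pair_alg le_preimage_def)
qed

lemma unary_decomposition_if_card_Rset_le_1:
  assumes card: "\<forall>p\<in>\<Omega>. \<forall>q\<in>\<Omega>. card (Rset ar p q) \<le> 1"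
  shows "unary_decomposition ar \<tau> \<MM>"
  unfolding unary_decomposition_def
proof (intro allI impI)
  fix n t assume n: "1 \<le> n" and t: "nary ar n t"
  \<comment> \<open>The finitely many points at which truth values are compared; taking extensional
    assignments on \<open>{..<n}\<close> keeps their number finite.\<close>
  define Pts where "Pts = (SIGMA p:\<Omega>. {..<n} \<rightarrow>\<^sub>E carrier (fst p))"
  define tval where "tval = (\<lambda>x :: (('f, 'a) alg \<times> ('a \<Rightarrow> bool)) \<times> (nat \<Rightarrow> 'a).
    snd (fst x) (eval (fst (fst x)) (snd x) t))"
  define uval where "uval = (\<lambda>(x :: (('f, 'a) alg \<times> ('a \<Rightarrow> bool)) \<times> (nat \<Rightarrow> 'a)) u i.
    snd (fst x) (eval (fst (fst x)) (\<lambda>_ :: nat. snd x i) u))"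
  have "finite (H (U \<tau> M))" if "M \<in> \<MM>" for M
  proof (rule finite_subset)
    show "H (U \<tau> M) \<subseteq> carrier M \<rightarrow>\<^sub>E (UNIV :: bool set)"
      by (auto simp: H_def hom_def two_def)
    show "finite (carrier M \<rightarrow>\<^sub>E (UNIV :: bool set))" using MM[OF that] by (intro finite_PiE) auto
  qed
  then have "finite \<Omega>" using finite_subset[OF Omega] finite_MM by blast
  then have finPts: "finite Pts"
    unfolding Pts_def using finite_Omega_carrier by (intro finite_SigmaI finite_PiE) auto
  \<comment> \<open>For each pair of a true and a false point of \<open>t\<close>, \<open>w\<close>
    will choose a unary term and a variable index that tell the two apart in the same
    direction.\<close>
  define Z where "Z = {x \<in> Pts. tval x} \<times> {y \<in> Pts. \<not> tval y}"
  have "\<exists>w. nary ar 1 (fst w) \<and> snd w < n \<and>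
      uval (fst z) (fst w) (snd w) \<and> \<not> uval (snd z) (fst w) (snd w)" if "z \<in> Z" for z
  proof -
    obtain p a q b where z: "z = ((p, a), (q, b))" by (metis surj_pair)
    with that have pq: "p \<in> \<Omega>" "q \<in> \<Omega>" and ab: "\<And>i. i < n \<Longrightarrow> a i \<in> carrier (fst p)"
      "\<And>i. i < n \<Longrightarrow> b i \<in> carrier (fst q)" and "tval (p, a)" "\<not> tval (q, b)"
      by (auto simp: Z_def Pts_def)
    then have "\<exists>u i. nary ar 1 u \<and> i < n \<and>
        snd p (eval (fst p) (\<lambda>_. a i) u) \<and> \<not> snd q (eval (fst q) (\<lambda>_. b i) u)"
      using card by (intro ex_separating_unary[OF _ pq t n ab]) (auto simp: tval_def)
    then show ?thesis by (auto simp: z uval_def)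
  qed
  then obtain w where w: "\<And>z. z \<in> Z \<Longrightarrow> nary ar 1 (fst (w z)) \<and> snd (w z) < n \<and>
      uval (fst z) (fst (w z)) (snd (w z)) \<and> \<not> uval (snd z) (fst (w z)) (snd (w z))"
    by metis
  have "finite Z" using finPts by (simp add: Z_def)
  \<comment> \<open>Enumerating \<open>Z\<close> supplies the variables of \<open>s\<close>:
    variable \<open>j\<close> stands for the unary term chosen for the pair
    \<open>e j\<close>.\<close>
  then obtain m e where e: "bij_betw e {0..<m :: nat} Z"
    using ex_bij_betw_nat_finite by blast
  define idx where "idx = inv_into {0..<m} e"
  have idx: "idx z < m" "e (idx z) = z" if "z \<in> Z" for z
    using that bij_betw_inv_into_right[OF e that] bij_betw_apply[OF bij_betw_inv_into[OF e] that]
    by (simp_all add: idx_def)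
  have eZ: "e j \<in> Z" if "j < m" for j using bij_betw_apply[OF e, of j] that by simp
  obtain xs where xs: "set xs = {x \<in> Pts. tval x}" using finite_list[of "{x \<in> Pts. tval x}"] finPts by auto
  obtain ys where ys: "set ys = {y \<in> Pts. \<not> tval y}" using finite_list[of "{y \<in> Pts. \<not> tval y}"] finPts by auto
  \<comment> \<open>A disjunctive normal form. If there are no true points it is the empty join
    \<open>Zero\<close>; if there are no false points, each meet is the empty meet
    \<open>One\<close>.\<close>
  define s where "s = big_join (map (\<lambda>x. big_meet (map (\<lambda>y. Var (idx (x, y))) ys)) xs)"
  have Z: "(x, y) \<in> Z" if "x \<in> set xs" "y \<in> set ys" for x y
    using that by (simp add: Z_def xs ys)
  have s: "nary dar m s"
    unfolding s_def by (rule nary_big_join) (auto intro!: nary_big_meet simp: nary_Var idx Z)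
  define ts where "ts = (\<lambda>j. fst (w (e j)))"
  define ix where "ix = (\<lambda>j. snd (w (e j)))"
  have ts: "nary ar 1 (ts j)" "ix j < n" if "j < m" for j
    using w[OF eZ[OF that]] by (simp_all add: ts_def ix_def)
  have eq: "eval A a t = eval (U \<tau> A) (\<lambda>j. eval A (\<lambda>_. a (ix j)) (ts j)) s"
    if A: "A \<in> ISP ar \<MM>" and a: "\<And>i. i < n \<Longrightarrow> a i \<in> carrier A" for A :: "('f, 'a) alg" and a
  proof (rule ccontr)
    let ?\<sigma> = "\<lambda>j. eval A (\<lambda>_. a (ix j)) (ts j)"
    note algA = ISP_algebra[OF A]
    note algU = algebra_U[OF nary_tau algA]
    assume neq: "eval A a t \<noteq> eval (U \<tau> A) ?\<sigma> s"
    have \<sigma>: "?\<sigma> j \<in> carrier (U \<tau> A)" if "j < m" for j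
      using eval_closed_nary[OF algA ts(1)[OF that]] a ts(2)[OF that] by simp
    have in1: "eval A a t \<in> carrier A" using eval_closed_nary[OF algA t a] .
    have in2: "eval (U \<tau> A) ?\<sigma> s \<in> carrier A" using eval_closed_nary[OF algU s \<sigma>] by simp
    obtain p g where p: "p \<in> \<Omega>" and g: "g \<in> hom ar A (fst p)"
      and pg: "snd p (g (eval A a t)) \<noteq> snd p (g (eval (U \<tau> A) ?\<sigma> s))"
      using ISP_Omega_separated[OF A in1 in2 neq] .
    \<comment> \<open>The homomorphism \<open>g\<close> turns the assignment in \<open>A\<close>
      into a point of \<open>Pts\<close>; \<open>s\<close> and \<open>t\<close> only have to agree
      there.\<close>
    define x0 where "x0 = (p, \<lambda>i\<in>{..<n}. g (a i))"
    have x0: "x0 \<in> Pts" using p a homD(1)[OF g] by (auto simp: x0_def Pts_def)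
    have "g (eval A a t) = eval (fst p) (\<lambda>i. g (a i)) t" using eval_hom_nary[OF algA g t a] .
    also have "\<dots> = eval (fst p) (snd x0) t" by (rule eval_cong_nary[OF t]) (simp add: x0_def)
    finally have tv: "snd p (g (eval A a t)) = tval x0" by (simp add: tval_def x0_def)
    define y where "y = compose (carrier A) (snd p) g"
    have "y \<in> hom dar (U \<tau> A) two"
      using hom_H[OF algA g OmegaD(2)[OF p]] by (simp add: y_def H_def)
    from eval_hom_nary[OF algU this s \<sigma>]
    have "y (eval (U \<tau> A) ?\<sigma> s) = eval two (\<lambda>j. y (?\<sigma> j)) s" .
    also have "\<dots> \<longleftrightarrow> (\<exists>x\<in>set xs. \<forall>z\<in>set ys. y (?\<sigma> (idx (x, z))))"
      by (simp add: s_def eval_two_big_join eval_two_big_meet)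
    also have "\<dots> \<longleftrightarrow> (\<exists>x\<in>set xs. \<forall>z\<in>set ys. uval x0 (fst (w (x, z))) (snd (w (x, z))))"
    proof (intro bex_cong ball_cong refl)
      fix x z assume "x \<in> set xs" "z \<in> set ys"
      then have j: "idx (x, z) < m" "e (idx (x, z)) = (x, z)" using idx[OF Z] by blast+
      have "?\<sigma> (idx (x, z)) \<in> carrier A" using \<sigma>[OF j(1)] by simp
      moreover have "g (?\<sigma> (idx (x, z))) =
          eval (fst p) (\<lambda>_. g (a (ix (idx (x, z))))) (ts (idx (x, z)))"
        using eval_hom_nary[OF algA g ts(1)[OF j(1)]] a ts(2)[OF j(1)] by simp
      ultimately show "y (?\<sigma> (idx (x, z))) = uval x0 (fst (w (x, z))) (snd (w (x, z)))"
        using ts(2)[OF j(1)] by (simp add: y_def compose_def uval_def x0_def ts_def ix_def j(2))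
    qed
    \<comment> \<open>If \<open>x0\<close> is a true point, the meet belonging to \<open>x0\<close>
      itself holds; if it is a false one, every meet fails in its factor for
      \<open>x0\<close>.\<close>
    also have "\<dots> \<longleftrightarrow> tval x0"
    proof (cases "tval x0")
      case True
      then have "x0 \<in> set xs" using x0 by (simp add: xs)
      moreover have "uval x0 (fst (w (x0, z))) (snd (w (x0, z)))" if "z \<in> set ys" for z
        using w[OF Z[OF \<open>x0 \<in> set xs\<close> that]] by simp
      ultimately show ?thesis using True by blast
    next
      case False
      then have "x0 \<in> set ys" using x0 by (simp add: ys)
      moreover have "\<not> uval x0 (fst (w (x, x0))) (snd (w (x, x0)))" if "x \<in> set xs" for x
        using w[OF Z[OF that \<open>x0 \<in> set ys\<close>]] by simp
      ultimately show ?thesis using False by blast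
    qed
    finally have "snd p (g (eval (U \<tau> A) ?\<sigma> s)) = tval x0"
      using in2 by (simp add: y_def compose_def)
    with pg tv show False by simp
  qed
  show "\<exists>m ts ix s. (\<forall>j<m. nary ar 1 (ts j) \<and> ix j < n) \<and> nary dar m s \<and>
    (\<forall>A\<in>ISP ar \<MM>. \<forall>a. (\<forall>i<n. a i \<in> carrier (A :: ('f, 'a) alg)) \<longrightarrow>
       eval A a t = eval (U \<tau> A) (\<lambda>j. eval A (\<lambda>_. a (ix j)) (ts j)) s)"
  proof (intro exI conjI allI impI ballI)
    show "nary ar 1 (ts j)" "ix j < n" if "j < m" for j using ts that by blast+
    show "nary dar m s" by (rule s)
    fix A :: "('f, 'a) alg" and a assume "A \<in> ISP ar \<MM>" "\<forall>i<n. a i \<in> carrier A"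
    then show "eval A a t = eval (U \<tau> A) (\<lambda>j. eval A (\<lambda>_. a (ix j)) (ts j)) s"
      by (intro eq) simp_all
  qed
qed

lemma preserves_free_coproducts_if_preserves_coproducts:
  assumes "preserves_coproducts ar \<tau> \<MM>"
  shows "preserves_free_coproducts ar \<tau> \<MM>"
  unfolding preserves_free_coproducts_def
proof (intro allI impI, elim conjE)
  fix F :: "('f, 'a) alg" and g and K :: "('f, 'a) alg set"
  assume F: "is_free1 ar (ISP ar \<MM>) F g" and K: "K \<noteq> {}" "\<forall>B\<in>K. algebra ar B \<and> iso ar F B"
  have "B \<in> ISP ar \<MM>" if "B \<in> K" for B
    using ISP_iso[OF algebra_MM, where A = F and B = B] F K(2) that by (simp add: is_free1_def)
  with K(1) show "chi_onto ar \<tau> \<MM> K"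
    using assms unfolding preserves_coproducts_def by (simp add: subset_iff)
qed

end

theorem theorem3p3:
  fixes ar :: "'f \<Rightarrow> nat"
    and \<tau> :: "dop \<Rightarrow> ('f, nat) trm"
    and \<MM> :: "('f, 'a) alg set"
    and \<Omega> :: "(('f, 'a) alg \<times> ('a \<Rightarrow> bool)) set"
  assumes "infinite (UNIV :: 'a set)"
    and "finite \<MM>"
    and "\<And>M. M \<in> \<MM> \<Longrightarrow> algebra ar M \<and> finite (carrier M)"
    and "D_based ar \<tau> (ISP ar \<MM> :: ('f, 'a) alg set)"
    and "\<Omega> \<subseteq> (SIGMA M:\<MM>. H (U \<tau> M))"
    and "Sep ar \<MM> \<Omega>"
  shows "(preserves_coproducts ar \<tau> \<MM> \<longleftrightarrow> preserves_free_coproducts ar \<tau> \<MM>) \<and>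
         (preserves_free_coproducts ar \<tau> \<MM> \<longleftrightarrow> unary_decomposition ar \<tau> \<MM>) \<and>
         (unary_decomposition ar \<tau> \<MM> \<longleftrightarrow> sublattices_have_top_subalgebra ar \<tau> \<MM>) \<and>
         (sublattices_have_top_subalgebra ar \<tau> \<MM> \<longleftrightarrow> (\<forall>p\<in>\<Omega>. \<forall>q\<in>\<Omega>. card (Rset ar p q) \<le> 1)) \<and>
         ((\<forall>p\<in>\<Omega>. \<forall>q\<in>\<Omega>. card (Rset ar p q) \<le> 1) \<longleftrightarrow> iotas_order_embeddings ar \<tau> \<MM>)"
proof -
  interpret finitely_generated_quasivariety ar \<tau> \<MM> \<Omega>
    by (rule finitely_generated_quasivariety.intro) (fact assms)+
  \<comment> \<open>Preservation of coproducts, its restriction to free algebras, the bound on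
    \<open>Rset\<close> and unary decomposition form a cycle. Top subalgebras lie on a path from
    unary decomposition to the bound, and order embeddings on one from preservation of coproducts to
    the bound.\<close>
  show ?thesis
    using preserves_free_coproducts_if_preserves_coproducts
      card_Rset_le_1_if_preserves_free_coproducts unary_decomposition_if_card_Rset_le_1
      preserves_coproducts_if_unary_decomposition iotas_order_embeddings_if_preserves_coproducts
      card_Rset_le_1_if_iotas_order_embeddings sublattices_have_top_if_unary_decomposition
      card_Rset_le_1_if_top_subalgebra
    by blast
qed

end
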